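(* Let $G$ be a finitely generated group. The following are equivalent. (a) There exists a subgroup $K<G$ with $e(G,K)>1$. (b) $G$ admits a non elliptic action on a discrete median algebra.
   Context: Ends: for a subgroup $K\le G$, let $\mathscr{P}K\backslash G$ be the set of subsets $A\subseteq G$ with $KA=A$, a right $\mathbb{F}_2G$-module under symmetric difference and right multiplication; let $\mathscr{F}K\backslash G$ be the submodule of $K$-finite sets, i.e. sets of the form $KF$ with $F\subseteq G$ finite. Then $e(G,K):=\dim_{\mathbb{F}_2}\big((\mathscr{P}K\backslash G)/(\mathscr{F}K\backslash G)\big)^G$, the dimension of the $G$-fixed submodule. A median algebra is a nonempty set $M$ with a map $m: M^3\to M$ such that: $m(x,y,z)=m(x,z,y)=m(y,z,x)$; $m(x,x,y)=x$; $m(m(x,y,z),u,v)=m(x,m(y,u,v),m(z,u,v))$. Interval: $[x,y]=\{z: z=m(x,y,z)\}$. $C\subseteq M$ is convex if $[x,y]\subseteq C$ for all $x,y\in C$. A half space is a subset $H\subseteq M$ such that $H$ and $M\setminus H$ are both convex. $\Delta(x,y)$ is the set of half spaces containing $x$ but not $y$; $M$ is discrete if all $\Delta(x,y)$ are finite, and then $d(x,y)=|\Delta(x,y)|$ is a metric on $M$. Groups act on median algebras by median automorphisms. The action of $G$ on a discrete median algebra $M$ is elliptic if for some (equivalently every) $x\in M$ the orbit $Gx$ is bounded (has finite diameter for $d$). *)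

theory Defs
  imports
    "HOL-Algebra.Group_Action"
    "HOL-Algebra.Generated_Groups"
    "HOL-Number_Theory.Residues"
    "HOL-Library.Extended_Nat"
    "Jordan_Normal_Form.Missing_VectorSpace"
begin

definition finitely_generated_group :: "('g, 'r) monoid_scheme \<Rightarrow> bool" where
  "finitely_generated_group G \<longleftrightarrow>
     group G \<and> (\<exists>S. finite S \<and> S \<subseteq> carrier G \<and> generate G S = carrier G)"


subsection \<open>The number of ends of a pair of groups\<close>

abbreviation F2 :: "int ring" where
  "F2 \<equiv> residue_ring 2"

text \<open>The dimension of a vector space, with value \<open>\<infinity>\<close> if there is no finite generating set
  (on such spaces \<open>vectorspace.dim\<close> is a junk value).\<close>

definition edim :: "('k, 'c) ring_scheme \<Rightarrow> ('k, 'v, 'd) module_scheme \<Rightarrow> enat" where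
  "edim K V = (if vectorspace.fin_dim K V then enat (vectorspace.dim K V) else \<infinity>)"

text \<open>Quotient of a module by a submodule. The fields \<open>mult\<close> and \<open>one\<close> that every module record
  inherits from rings are irrelevant, here and below.\<close>

definition quotient_module :: "('k, 'v, 'd) module_scheme \<Rightarrow> 'v set \<Rightarrow> ('k, 'v set) module" where
  "quotient_module V N =
     \<lparr>carrier = a_rcosets\<^bsub>V\<^esub> N, monoid.mult = undefined, one = undefined,
      zero = N, add = set_add V,
      smult = (\<lambda>c S. \<Union>x\<in>S. N +>\<^bsub>V\<^esub> (c \<odot>\<^bsub>V\<^esub> x))\<rparr>"

text \<open>\<open>PKG\<close> consists of the left \<open>K\<close>-invariant subsets of \<open>G\<close>, \<open>FKG\<close> of the \<open>K\<close>-finite ones.\<close>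

definition PKG :: "('g, 'r) monoid_scheme \<Rightarrow> 'g set \<Rightarrow> (int, 'g set) module" where
  "PKG G K =
     \<lparr>carrier = {A. A \<subseteq> carrier G \<and> K <#>\<^bsub>G\<^esub> A = A}, monoid.mult = undefined, one = undefined,
      zero = {}, add = sym_diff,
      smult = (\<lambda>c A. if c = \<zero>\<^bsub>F2\<^esub> then {} else A)\<rparr>"

definition FKG :: "('g, 'r) monoid_scheme \<Rightarrow> 'g set \<Rightarrow> 'g set set" where
  "FKG G K = {K <#>\<^bsub>G\<^esub> F | F. finite F \<and> F \<subseteq> carrier G}"

text \<open>A set \<open>S\<close> is a class modulo \<open>FKG G K\<close>, that is, a set of subsets of the group. The element
  \<open>g\<close> maps the class of \<open>A\<close> to the class of \<open>A g\<close>; since \<open>FKG G K\<close> is stable under right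
  multiplication, this is the image of \<open>S\<close> under \<open>A \<mapsto> A g\<close>.\<close>

definition ends_fixed :: "('g, 'r) monoid_scheme \<Rightarrow> 'g set \<Rightarrow> 'g set set set" where
  "ends_fixed G K =
     {S \<in> carrier (quotient_module (PKG G K) (FKG G K)).
        \<forall>g\<in>carrier G. (\<lambda>A. A #>\<^bsub>G\<^esub> g) ` S = S}"

definition ends :: "('g, 'r) monoid_scheme \<Rightarrow> 'g set \<Rightarrow> enat" where
  "ends G K =
     edim F2 ((quotient_module (PKG G K) (FKG G K))\<lparr>carrier := ends_fixed G K\<rparr>)"


text \<open>The remaining facts of this section lead to \<open>ends_vectorspace\<close>: the fixed submodule is a
  vector space over \<open>F2\<close>, so that \<open>vectorspace.fin_dim\<close> and \<open>vectorspace.dim\<close> have their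
  intended meaning in \<open>ends\<close>.\<close>

lemma submodule_abelian_subgroup:
  assumes "module R V" "submodule R N V"
  shows "abelian_subgroup N V"
proof -
  interpret module R V by fact
  interpret S: submodule R N V by fact
  show ?thesis
  proof (rule abelian_subgroupI3)
    show "additive_subgroup N V"
    proof (rule additive_subgroupI, rule M.add.subgroupI)
      show "N \<subseteq> carrier V" by (rule S.subset)
      show "N \<noteq> {}" using S.zero_closed by blast
      show "x \<oplus>\<^bsub>V\<^esub> y \<in> N" if "x \<in> N" "y \<in> N" for x y using that by (rule S.m_closed)
      show "\<ominus>\<^bsub>V\<^esub> x \<in> N" if "x \<in> N" for x
      proof -
        have "(\<ominus>\<^bsub>R\<^esub> \<one>\<^bsub>R\<^esub>) \<odot>\<^bsub>V\<^esub> x \<in> N" using that by (intro S.smult_closed) auto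
        moreover have "(\<ominus>\<^bsub>R\<^esub> \<one>\<^bsub>R\<^esub>) \<odot>\<^bsub>V\<^esub> x = \<ominus>\<^bsub>V\<^esub> x"
          using that S.subset smult_l_minus[of "\<one>\<^bsub>R\<^esub>" x] by auto
        ultimately show ?thesis by simp
      qed
    qed
    show "abelian_group V" by (rule M.abelian_group_axioms)
  qed
qed

lemma quotient_module_smult_coset:
  assumes "module R V" "submodule R N V" "c \<in> carrier R" "x \<in> carrier V"
  shows "c \<odot>\<^bsub>quotient_module V N\<^esub> (N +>\<^bsub>V\<^esub> x) = N +>\<^bsub>V\<^esub> (c \<odot>\<^bsub>V\<^esub> x)"
proof -
  interpret module R V by fact
  interpret S: submodule R N V by fact
  interpret A: abelian_subgroup N V by (rule submodule_abelian_subgroup) fact+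
  have "N +>\<^bsub>V\<^esub> (c \<odot>\<^bsub>V\<^esub> y) = N +>\<^bsub>V\<^esub> (c \<odot>\<^bsub>V\<^esub> x)" if yx: "y \<in> N +>\<^bsub>V\<^esub> x" for y
  proof -
    obtain n where n: "n \<in> N" "y = n \<oplus>\<^bsub>V\<^esub> x" using yx by (auto simp: a_r_coset_def')
    have nV: "n \<in> carrier V" using n S.subset by auto
    have "c \<odot>\<^bsub>V\<^esub> y = c \<odot>\<^bsub>V\<^esub> n \<oplus>\<^bsub>V\<^esub> c \<odot>\<^bsub>V\<^esub> x" using n nV assms by (simp add: smult_r_distr)
    moreover have "c \<odot>\<^bsub>V\<^esub> n \<in> N" using n assms by auto
    ultimately have "c \<odot>\<^bsub>V\<^esub> y \<in> N +>\<^bsub>V\<^esub> (c \<odot>\<^bsub>V\<^esub> x)" by (auto simp: a_r_coset_def')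
    then show ?thesis using A.a_repr_independence' assms by auto
  qed
  moreover have "x \<in> N +>\<^bsub>V\<^esub> x" using A.a_rcos_self assms by auto
  ultimately have "(\<Union>y\<in>N +>\<^bsub>V\<^esub> x. N +>\<^bsub>V\<^esub> (c \<odot>\<^bsub>V\<^esub> y)) = N +>\<^bsub>V\<^esub> (c \<odot>\<^bsub>V\<^esub> x)"
    by blast
  then show ?thesis by (simp only: quotient_module_def module.select_convs)
qed

lemma quotient_module_module:
  assumes "module R V" "submodule R N V"
  shows "module R (quotient_module V N)"
proof -
  let ?Q = "quotient_module V N"
  interpret module R V by fact
  interpret S: submodule R N V by fact
  interpret A: abelian_subgroup N V by (rule submodule_abelian_subgroup) fact+
  note sm = quotient_module_smult_coset[OF assms]
  have c: "\<exists>x\<in>carrier V. X = N +>\<^bsub>V\<^esub> x" if "X \<in> carrier ?Q" for X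
    using that by (auto simp: quotient_module_def A_RCOSETS_def')
  have ci: "N +>\<^bsub>V\<^esub> x \<in> carrier ?Q" if "x \<in> carrier V" for x
    using that by (auto simp: quotient_module_def A_RCOSETS_def')
  have ad: "(N +>\<^bsub>V\<^esub> x) \<oplus>\<^bsub>?Q\<^esub> (N +>\<^bsub>V\<^esub> y) = N +>\<^bsub>V\<^esub> (x \<oplus>\<^bsub>V\<^esub> y)"
    if "x \<in> carrier V" "y \<in> carrier V" for x y
    using A.a_rcos_sum that by (auto simp: quotient_module_def)
  show ?thesis
  proof (rule moduleI)
    show "cring R" by (rule R.cring_axioms)
    have z: "\<zero>\<^bsub>?Q\<^esub> = N +>\<^bsub>V\<^esub> \<zero>\<^bsub>V\<^esub>"
      using M.a_coset_add_zero[of N] S.subset by (simp add: quotient_module_def)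
    show "abelian_group ?Q"
    proof (rule abelian_groupI)
      fix X assume "X \<in> carrier ?Q"
      then obtain x where "x \<in> carrier V" "X = N +>\<^bsub>V\<^esub> x" using c by blast
      then show "\<exists>y\<in>carrier ?Q. y \<oplus>\<^bsub>?Q\<^esub> X = \<zero>\<^bsub>?Q\<^esub>"
        using ad ci by (intro bexI[of _ "N +>\<^bsub>V\<^esub> (\<ominus>\<^bsub>V\<^esub> x)"]) (auto simp: z M.l_neg)
    next
      fix X Y assume "X \<in> carrier ?Q" "Y \<in> carrier ?Q"
      then obtain x y where "x \<in> carrier V" "X = N +>\<^bsub>V\<^esub> x" "y \<in> carrier V" "Y = N +>\<^bsub>V\<^esub> y"
        using c by metis
      then show "X \<oplus>\<^bsub>?Q\<^esub> Y \<in> carrier ?Q" "X \<oplus>\<^bsub>?Q\<^esub> Y = Y \<oplus>\<^bsub>?Q\<^esub> X"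
        using ad ci by (simp_all add: M.a_comm)
    next
      fix X Y Z assume "X \<in> carrier ?Q" "Y \<in> carrier ?Q" "Z \<in> carrier ?Q"
      then obtain x y w where "x \<in> carrier V" "X = N +>\<^bsub>V\<^esub> x" "y \<in> carrier V" "Y = N +>\<^bsub>V\<^esub> y"
         "w \<in> carrier V" "Z = N +>\<^bsub>V\<^esub> w"
        using c by metis
      then show "X \<oplus>\<^bsub>?Q\<^esub> Y \<oplus>\<^bsub>?Q\<^esub> Z = X \<oplus>\<^bsub>?Q\<^esub> (Y \<oplus>\<^bsub>?Q\<^esub> Z)"
        using ad ci by (simp add: M.a_assoc)
    next
      show "\<zero>\<^bsub>?Q\<^esub> \<in> carrier ?Q" using ci z by simp
    next
      fix X assume "X \<in> carrier ?Q"
      then obtain x where "x \<in> carrier V" "X = N +>\<^bsub>V\<^esub> x" using c by metis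
      then show "\<zero>\<^bsub>?Q\<^esub> \<oplus>\<^bsub>?Q\<^esub> X = X" unfolding z using ad by simp
    qed
  next
    fix a X assume a: "a \<in> carrier R" "X \<in> carrier ?Q"
    then obtain x where x: "x \<in> carrier V" "X = N +>\<^bsub>V\<^esub> x" using c by metis
    show "a \<odot>\<^bsub>?Q\<^esub> X \<in> carrier ?Q" using a x ci sm by simp
    fix b assume b: "b \<in> carrier R"
    show "(a \<oplus>\<^bsub>R\<^esub> b) \<odot>\<^bsub>?Q\<^esub> X = a \<odot>\<^bsub>?Q\<^esub> X \<oplus>\<^bsub>?Q\<^esub> b \<odot>\<^bsub>?Q\<^esub> X"
      using a b x ad sm by (simp add: smult_l_distr)
    show "(a \<otimes>\<^bsub>R\<^esub> b) \<odot>\<^bsub>?Q\<^esub> X = a \<odot>\<^bsub>?Q\<^esub> (b \<odot>\<^bsub>?Q\<^esub> X)"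
      using a b x sm by (simp add: smult_assoc1)
  next
    fix a X Y assume a: "a \<in> carrier R" "X \<in> carrier ?Q" "Y \<in> carrier ?Q"
    then obtain x y where "x \<in> carrier V" "X = N +>\<^bsub>V\<^esub> x" "y \<in> carrier V" "Y = N +>\<^bsub>V\<^esub> y"
      using c by metis
    then show "a \<odot>\<^bsub>?Q\<^esub> (X \<oplus>\<^bsub>?Q\<^esub> Y) = a \<odot>\<^bsub>?Q\<^esub> X \<oplus>\<^bsub>?Q\<^esub> a \<odot>\<^bsub>?Q\<^esub> Y"
      using a ad sm by (simp add: smult_r_distr)
  next
    fix X assume "X \<in> carrier ?Q"
    then obtain x where "x \<in> carrier V" "X = N +>\<^bsub>V\<^esub> x" using c by metis
    then show "\<one>\<^bsub>R\<^esub> \<odot>\<^bsub>?Q\<^esub> X = X" using sm by simp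
  qed
qed

lemma field_F2: "field F2"
  using residues_prime.is_field[of 2] two_is_prime_nat
  by (simp add: residues_prime_def)

lemma PKG_closed:
  assumes "group G" "subgroup K G" and sub: "A \<subseteq> carrier G"
  shows "K <#>\<^bsub>G\<^esub> A = A \<longleftrightarrow> (\<forall>k\<in>K. \<forall>a\<in>A. k \<otimes>\<^bsub>G\<^esub> a \<in> A)"
proof -
  interpret group G by fact
  interpret K: subgroup K G by fact
  have "A \<subseteq> K <#>\<^bsub>G\<^esub> A"
  proof
    fix a assume a: "a \<in> A"
    then have "a = \<one>\<^bsub>G\<^esub> \<otimes>\<^bsub>G\<^esub> a" using sub by (simp add: subsetD)
    then show "a \<in> K <#>\<^bsub>G\<^esub> A" unfolding set_mult_def using a K.one_closed by blast
  qed
  then show ?thesis unfolding set_mult_def by blast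
qed

lemma PKG_diff:
  assumes "group G" "subgroup K G" "A \<subseteq> carrier G" "B \<subseteq> carrier G"
     "K <#>\<^bsub>G\<^esub> A = A" "K <#>\<^bsub>G\<^esub> B = B"
  shows "K <#>\<^bsub>G\<^esub> sym_diff A B = sym_diff A B"
proof -
  interpret group G by fact
  interpret K: subgroup K G by fact
  have iff: "k \<otimes>\<^bsub>G\<^esub> a \<in> C \<longleftrightarrow> a \<in> C"
    if C: "C \<subseteq> carrier G" "K <#>\<^bsub>G\<^esub> C = C" and "k \<in> K" "a \<in> carrier G" for C k a
  proof
    assume "k \<otimes>\<^bsub>G\<^esub> a \<in> C"
    then have "inv\<^bsub>G\<^esub> k \<otimes>\<^bsub>G\<^esub> (k \<otimes>\<^bsub>G\<^esub> a) \<in> C"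
      using PKG_closed[OF assms(1,2) C(1)] C that by auto
    then show "a \<in> C" using that by (simp add: m_assoc[symmetric])
  qed (use PKG_closed[OF assms(1,2) C(1)] C that in auto)
  have s: "sym_diff A B \<subseteq> carrier G" using assms by auto
  show ?thesis unfolding PKG_closed[OF assms(1,2) s]
  proof (intro ballI)
    fix k a assume ka: "k \<in> K" "a \<in> sym_diff A B"
    have "a \<in> carrier G" using ka(2) s by blast
    then have "k \<otimes>\<^bsub>G\<^esub> a \<in> A \<longleftrightarrow> a \<in> A" "k \<otimes>\<^bsub>G\<^esub> a \<in> B \<longleftrightarrow> a \<in> B"
      using iff[OF assms(3,5) ka(1)] iff[OF assms(4,6) ka(1)] by blast+
    then show "k \<otimes>\<^bsub>G\<^esub> a \<in> sym_diff A B" using ka(2) by blast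
  qed
qed

lemma PKG_simps:
  "carrier (PKG G K) = {A. A \<subseteq> carrier G \<and> K <#>\<^bsub>G\<^esub> A = A}"
  "x \<oplus>\<^bsub>PKG G K\<^esub> y = sym_diff x y" "\<zero>\<^bsub>PKG G K\<^esub> = {}"
  "c \<odot>\<^bsub>PKG G K\<^esub> x = (if c = 0 then {} else x)"
  by (simp_all add: PKG_def residue_ring_def)

lemma PKG_module:
  assumes "group G" "subgroup K G"
  shows "module F2 (PKG G K)"
proof (rule moduleI)
  show "cring F2" by (rule domain.axioms(1)[OF field.axioms(1)[OF field_F2]])
  have e: "K <#>\<^bsub>G\<^esub> {} = {}" by (simp add: set_mult_def)
  show "abelian_group (PKG G K)"
  proof (rule abelian_groupI)
    fix x assume "x \<in> carrier (PKG G K)"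
    then show "\<exists>y\<in>carrier (PKG G K). y \<oplus>\<^bsub>PKG G K\<^esub> x = \<zero>\<^bsub>PKG G K\<^esub>"
      by (intro bexI[of _ x]) (simp_all add: PKG_simps)
    show "\<zero>\<^bsub>PKG G K\<^esub> \<oplus>\<^bsub>PKG G K\<^esub> x = x" by (simp add: PKG_simps)
  next
    fix x y assume xy: "x \<in> carrier (PKG G K)" "y \<in> carrier (PKG G K)"
    then have "sym_diff x y \<subseteq> carrier G" unfolding PKG_simps by blast
    then show "x \<oplus>\<^bsub>PKG G K\<^esub> y \<in> carrier (PKG G K)"
      using PKG_diff[OF assms, of x y] xy by (simp only: PKG_simps mem_Collect_eq)
    show "x \<oplus>\<^bsub>PKG G K\<^esub> y = y \<oplus>\<^bsub>PKG G K\<^esub> x" unfolding PKG_simps by blast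
  next
    fix x y z
    show "x \<oplus>\<^bsub>PKG G K\<^esub> y \<oplus>\<^bsub>PKG G K\<^esub> z = x \<oplus>\<^bsub>PKG G K\<^esub> (y \<oplus>\<^bsub>PKG G K\<^esub> z)"
      unfolding PKG_simps by blast
  next
    show "\<zero>\<^bsub>PKG G K\<^esub> \<in> carrier (PKG G K)" using e by (simp add: PKG_simps)
  qed
next
  fix a b x assume "a \<in> carrier F2" "b \<in> carrier F2"
  then have "(a = 0 \<or> a = 1) \<and> (b = 0 \<or> b = 1)" by (auto simp: residue_ring_def)
  then show "(a \<oplus>\<^bsub>F2\<^esub> b) \<odot>\<^bsub>PKG G K\<^esub> x = a \<odot>\<^bsub>PKG G K\<^esub> x \<oplus>\<^bsub>PKG G K\<^esub> b \<odot>\<^bsub>PKG G K\<^esub> x"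
    "(a \<otimes>\<^bsub>F2\<^esub> b) \<odot>\<^bsub>PKG G K\<^esub> x = a \<odot>\<^bsub>PKG G K\<^esub> (b \<odot>\<^bsub>PKG G K\<^esub> x)"
    by (elim conjE disjE; simp add: PKG_simps residue_ring_def)+
next
  have e: "K <#>\<^bsub>G\<^esub> {} = {}" by (simp add: set_mult_def)
  then show "a \<odot>\<^bsub>PKG G K\<^esub> x \<in> carrier (PKG G K)" if "x \<in> carrier (PKG G K)" for a x
    using that by (simp add: PKG_simps)
  show "a \<odot>\<^bsub>PKG G K\<^esub> (x \<oplus>\<^bsub>PKG G K\<^esub> y) = a \<odot>\<^bsub>PKG G K\<^esub> x \<oplus>\<^bsub>PKG G K\<^esub> a \<odot>\<^bsub>PKG G K\<^esub> y" for a x y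
    by (simp add: PKG_simps)
  show "\<one>\<^bsub>F2\<^esub> \<odot>\<^bsub>PKG G K\<^esub> x = x" for x
    by (simp add: PKG_simps residue_ring_def)
qed

lemma FKG_subset_closed: 
  assumes "group G" "subgroup K G" "F \<subseteq> carrier G" "finite F" "A \<subseteq> K <#>\<^bsub>G\<^esub> F" "K <#>\<^bsub>G\<^esub> A = A"
  shows "\<exists>E. finite E \<and> E \<subseteq> carrier G \<and> A = K <#>\<^bsub>G\<^esub> E"
proof -
  interpret group G by fact
  interpret K: subgroup K G by fact
  have "K <#>\<^bsub>G\<^esub> F \<subseteq> carrier G" using assms(3) K.subset by (intro set_mult_closed) auto
  then have Ac: "A \<subseteq> carrier G" using assms(5) by blast
  note cl = PKG_closed[OF assms(1,2) Ac, THEN iffD1, OF assms(6), rule_format]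
  have "A = K <#>\<^bsub>G\<^esub> (F \<inter> A)"
  proof (intro equalityI subsetI)
    fix a assume a: "a \<in> A"
    then have "a \<in> K <#>\<^bsub>G\<^esub> F" using assms(5) by blast
    then obtain k f where kf: "k \<in> K" "f \<in> F" "a = k \<otimes>\<^bsub>G\<^esub> f" unfolding set_mult_def by blast
    have f: "f \<in> carrier G" "k \<in> carrier G" using kf assms(3) K.subset by blast+
    have "inv\<^bsub>G\<^esub> k \<otimes>\<^bsub>G\<^esub> a \<in> A" using cl a kf(1) K.m_inv_closed by blast
    then have "f \<in> A" using f by (simp add: kf(3) m_assoc[symmetric])
    then show "a \<in> K <#>\<^bsub>G\<^esub> (F \<inter> A)" using kf unfolding set_mult_def by blast
  next
    fix a assume "a \<in> K <#>\<^bsub>G\<^esub> (F \<inter> A)"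
    then obtain k f where "k \<in> K" "f \<in> A" "a = k \<otimes>\<^bsub>G\<^esub> f" unfolding set_mult_def by blast
    then show "a \<in> A" using cl by blast
  qed
  moreover have "finite (F \<inter> A)" "F \<inter> A \<subseteq> carrier G" using assms(3,4) by auto
  ultimately show ?thesis by blast
qed

lemma FKG_closed:
  assumes "group G" "subgroup K G" "S \<in> FKG G K"
  shows "S \<subseteq> carrier G \<and> K <#>\<^bsub>G\<^esub> S = S"
proof -
  interpret group G by fact
  interpret K: subgroup K G by fact
  obtain F where F: "finite F" "F \<subseteq> carrier G" "S = K <#>\<^bsub>G\<^esub> F" using assms by (auto simp: FKG_def)
  have Sc: "S \<subseteq> carrier G" using F by (auto simp: set_mult_def)
  have "k \<otimes>\<^bsub>G\<^esub> (h \<otimes>\<^bsub>G\<^esub> f) \<in> S" if "k \<in> K" "h \<in> K" "f \<in> F" for k h f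
  proof -
    have "k \<otimes>\<^bsub>G\<^esub> (h \<otimes>\<^bsub>G\<^esub> f) = (k \<otimes>\<^bsub>G\<^esub> h) \<otimes>\<^bsub>G\<^esub> f" using that F by (auto simp: m_assoc)
    then show ?thesis unfolding F set_mult_def using that K.m_closed by blast
  qed
  moreover have "\<exists>h\<in>K. \<exists>f\<in>F. a = h \<otimes>\<^bsub>G\<^esub> f" if "a \<in> S" for a
    using that unfolding F(3) set_mult_def by blast
  ultimately have "\<forall>k\<in>K. \<forall>a\<in>S. k \<otimes>\<^bsub>G\<^esub> a \<in> S" by metis
  then show ?thesis using PKG_closed[OF assms(1,2) Sc] Sc by simp
qed

lemma FKG_submodule:
  assumes "group G" "subgroup K G"
  shows "submodule F2 (FKG G K) (PKG G K)"
proof (rule submodule.intro)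
  show "module F2 (PKG G K)" by (rule PKG_module[OF assms])
  show "FKG G K \<subseteq> carrier (PKG G K)" using FKG_closed[OF assms] by (auto simp: PKG_def)
  have e: "{} \<in> FKG G K" unfolding FKG_def by (auto simp: set_mult_def intro!: exI[of _ "{}"])
  then show "\<zero>\<^bsub>PKG G K\<^esub> \<in> FKG G K" by (simp add: PKG_def)
  show "c \<odot>\<^bsub>PKG G K\<^esub> v \<in> FKG G K" if "c \<in> carrier F2" "v \<in> FKG G K" for c v
    using that e by (simp add: PKG_simps)
  fix v w assume vw: "v \<in> FKG G K" "w \<in> FKG G K"
  obtain E F where EF: "finite E" "E \<subseteq> carrier G" "v = K <#>\<^bsub>G\<^esub> E"
    "finite F" "F \<subseteq> carrier G" "w = K <#>\<^bsub>G\<^esub> F" using vw by (auto simp: FKG_def)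
  have su: "sym_diff v w \<subseteq> K <#>\<^bsub>G\<^esub> (E \<union> F)" unfolding EF set_mult_def by blast
  have inv: "K <#>\<^bsub>G\<^esub> sym_diff v w = sym_diff v w"
    using FKG_closed[OF assms vw(1)] FKG_closed[OF assms vw(2)] by (intro PKG_diff[OF assms]) blast+
  have "\<exists>D. finite D \<and> D \<subseteq> carrier G \<and> sym_diff v w = K <#>\<^bsub>G\<^esub> D"
    using EF by (intro FKG_subset_closed[OF assms _ _ su inv]) blast+
  then show "v \<oplus>\<^bsub>PKG G K\<^esub> w \<in> FKG G K" unfolding PKG_simps FKG_def by blast
qed

lemma r_coset_sym_diff:
  assumes "group G" "A \<subseteq> carrier G" "B \<subseteq> carrier G" "g \<in> carrier G"
  shows "sym_diff A B #>\<^bsub>G\<^esub> g = sym_diff (A #>\<^bsub>G\<^esub> g) (B #>\<^bsub>G\<^esub> g)"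
proof -
  interpret group G by fact
  have e: "C #>\<^bsub>G\<^esub> g = (\<lambda>x. x \<otimes>\<^bsub>G\<^esub> g) ` C" for C by (auto simp: r_coset_def)
  have inj: "inj_on (\<lambda>x. x \<otimes>\<^bsub>G\<^esub> g) (carrier G)" using assms(4) by (simp add: inj_on_def)
  have "A - B \<subseteq> carrier G" "B - A \<subseteq> carrier G" using assms by blast+
  then show ?thesis
    unfolding e image_Un
    using inj_on_image_set_diff[OF inj _ assms(3)] inj_on_image_set_diff[OF inj _ assms(2)] by simp
qed

lemma FKG_r_coset:
  assumes "group G" "subgroup K G" "S \<in> FKG G K" "g \<in> carrier G"
  shows "S #>\<^bsub>G\<^esub> g \<in> FKG G K"
proof -
  interpret group G by fact
  interpret K: subgroup K G by fact
  obtain F where F: "finite F" "F \<subseteq> carrier G" "S = K <#>\<^bsub>G\<^esub> F" using assms by (auto simp: FKG_def)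
  have "S #>\<^bsub>G\<^esub> g = K <#>\<^bsub>G\<^esub> (F #>\<^bsub>G\<^esub> g)"
    unfolding F(3) by (rule setmult_rcos_assoc[symmetric, OF K.subset F(2) assms(4)])
  moreover have "finite (F #>\<^bsub>G\<^esub> g)" "F #>\<^bsub>G\<^esub> g \<subseteq> carrier G"
    using F assms by (auto simp: r_coset_def)
  ultimately show ?thesis by (auto simp: FKG_def)
qed

lemma coset_action:
  assumes "group G" "subgroup K G" "A \<in> carrier (PKG G K)" "g \<in> carrier G"
  shows "(\<lambda>B. B #>\<^bsub>G\<^esub> g) ` (FKG G K +>\<^bsub>PKG G K\<^esub> A) = FKG G K +>\<^bsub>PKG G K\<^esub> (A #>\<^bsub>G\<^esub> g)"
proof -
  interpret group G by fact
  have A: "A \<subseteq> carrier G" using assms by (auto simp: PKG_def)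
  have im: "(\<lambda>B. B #>\<^bsub>G\<^esub> g) ` FKG G K = FKG G K"
  proof (intro equalityI subsetI)
    fix S assume S: "S \<in> FKG G K"
    have "S = (S #>\<^bsub>G\<^esub> inv\<^bsub>G\<^esub> g) #>\<^bsub>G\<^esub> g"
      using FKG_closed[OF assms(1,2) S] assms by (simp add: coset_mult_assoc coset_mult_one)
    then show "S \<in> (\<lambda>B. B #>\<^bsub>G\<^esub> g) ` FKG G K" using FKG_r_coset[OF assms(1,2) S] assms by blast
  qed (use FKG_r_coset[OF assms(1,2)] assms in auto)
  have "(\<lambda>B. B #>\<^bsub>G\<^esub> g) ` (FKG G K +>\<^bsub>PKG G K\<^esub> A) = (\<lambda>S. sym_diff S A #>\<^bsub>G\<^esub> g) ` FKG G K"
    by (auto simp: a_r_coset_def' PKG_def)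
  also have "\<dots> = (\<lambda>S. sym_diff (S #>\<^bsub>G\<^esub> g) (A #>\<^bsub>G\<^esub> g)) ` FKG G K"
    using r_coset_sym_diff[OF assms(1) _ A assms(4)] FKG_closed[OF assms(1,2)] by (intro image_cong) auto
  also have "\<dots> = (\<lambda>S. sym_diff S (A #>\<^bsub>G\<^esub> g)) ` ((\<lambda>B. B #>\<^bsub>G\<^esub> g) ` FKG G K)"
    by (simp add: image_image)
  also have "\<dots> = FKG G K +>\<^bsub>PKG G K\<^esub> (A #>\<^bsub>G\<^esub> g)"
    unfolding im by (auto simp: a_r_coset_def' PKG_def)
  finally show ?thesis .
qed

lemma ends_vectorspace:
  assumes "group G" "subgroup K G"
  shows "vectorspace F2 ((quotient_module (PKG G K) (FKG G K))\<lparr>carrier := ends_fixed G K\<rparr>)"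
proof -
  let ?P = "PKG G K" and ?F = "FKG G K"
  let ?Q = "quotient_module ?P ?F"
  interpret group G by fact
  interpret K: subgroup K G by fact
  note mP = PKG_module[OF assms] and sF = FKG_submodule[OF assms]
  note mQ = quotient_module_module[OF mP sF]
  interpret P: module F2 ?P by fact
  interpret Q: module F2 ?Q by fact
  interpret A: abelian_subgroup ?F ?P by (rule submodule_abelian_subgroup[OF mP sF])
  have c: "\<exists>x\<in>carrier ?P. X = ?F +>\<^bsub>?P\<^esub> x" if "X \<in> carrier ?Q" for X
    using that by (auto simp: quotient_module_def A_RCOSETS_def')
  have ci: "?F +>\<^bsub>?P\<^esub> x \<in> carrier ?Q" if "x \<in> carrier ?P" for x
    using that by (auto simp: quotient_module_def A_RCOSETS_def')
  have ad: "(?F +>\<^bsub>?P\<^esub> x) \<oplus>\<^bsub>?Q\<^esub> (?F +>\<^bsub>?P\<^esub> y) = ?F +>\<^bsub>?P\<^esub> (x \<oplus>\<^bsub>?P\<^esub> y)"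
    if "x \<in> carrier ?P" "y \<in> carrier ?P" for x y
    using A.a_rcos_sum that by (auto simp: quotient_module_def)
  have rc: "x #>\<^bsub>G\<^esub> g \<in> carrier ?P" if x: "x \<in> carrier ?P" and g: "g \<in> carrier G" for x g
  proof -
    have "K <#>\<^bsub>G\<^esub> (x #>\<^bsub>G\<^esub> g) = (K <#>\<^bsub>G\<^esub> x) #>\<^bsub>G\<^esub> g"
      using x by (intro setmult_rcos_assoc[OF K.subset _ g]) (simp add: PKG_simps)
    moreover have "x #>\<^bsub>G\<^esub> g \<subseteq> carrier G"
      using x g by (intro r_coset_subset_G) (simp_all add: PKG_simps)
    ultimately show ?thesis using x by (simp add: PKG_simps)
  qed
  have z: "\<zero>\<^bsub>?Q\<^esub> \<in> ends_fixed G K"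
  proof -
    have "(\<lambda>A. A #>\<^bsub>G\<^esub> g) ` ?F = ?F" if "g \<in> carrier G" for g
    proof -
      have "?F +>\<^bsub>?P\<^esub> {} = ?F" by (simp add: a_r_coset_def' PKG_simps)
      moreover have "{} \<in> carrier ?P" using P.zero_closed by (simp only: PKG_simps)
      ultimately show ?thesis using coset_action[OF assms _ that, of "{}"] by (simp add: r_coset_def)
    qed
    moreover have "\<zero>\<^bsub>?Q\<^esub> = ?F" by (simp add: quotient_module_def)
    ultimately show ?thesis using Q.zero_closed unfolding ends_fixed_def by simp
  qed
  have "submodule F2 (ends_fixed G K) ?Q"
  proof (rule submodule.intro)
    show "module F2 ?Q" by fact
    show "ends_fixed G K \<subseteq> carrier ?Q" by (auto simp: ends_fixed_def)
    show "\<zero>\<^bsub>?Q\<^esub> \<in> ends_fixed G K" by (rule z)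
    show "s \<odot>\<^bsub>?Q\<^esub> v \<in> ends_fixed G K" if "s \<in> carrier F2" "v \<in> ends_fixed G K" for s v
    proof -
      have v: "v \<in> carrier ?Q" using that by (simp add: ends_fixed_def)
      have "s = 0 \<or> s = 1" using that(1) by (auto simp: residue_ring_def)
      then have "s = \<zero>\<^bsub>F2\<^esub> \<or> s = \<one>\<^bsub>F2\<^esub>" by (auto simp: residue_ring_def)
      then show ?thesis using that(2) v z Q.smult_l_null[OF v] Q.smult_one[OF v] by auto
    qed
    fix v w assume vw: "v \<in> ends_fixed G K" "w \<in> ends_fixed G K"
    have vQ: "v \<in> carrier ?Q" and wQ: "w \<in> carrier ?Q"
      using vw by (simp_all add: ends_fixed_def)
    obtain x where x: "x \<in> carrier ?P" "v = ?F +>\<^bsub>?P\<^esub> x" using c[OF vQ] by blast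
    obtain y where y: "y \<in> carrier ?P" "w = ?F +>\<^bsub>?P\<^esub> y" using c[OF wQ] by blast
    have "(\<lambda>A. A #>\<^bsub>G\<^esub> g) ` (v \<oplus>\<^bsub>?Q\<^esub> w) = v \<oplus>\<^bsub>?Q\<^esub> w" if g: "g \<in> carrier G" for g
    proof -
      have s: "(x \<oplus>\<^bsub>?P\<^esub> y) #>\<^bsub>G\<^esub> g = (x #>\<^bsub>G\<^esub> g) \<oplus>\<^bsub>?P\<^esub> (y #>\<^bsub>G\<^esub> g)"
        using r_coset_sym_diff[OF assms(1) _ _ g, of x y] x(1) y(1) by (simp add: PKG_simps)
      have "(\<lambda>A. A #>\<^bsub>G\<^esub> g) ` (v \<oplus>\<^bsub>?Q\<^esub> w) = ?F +>\<^bsub>?P\<^esub> ((x \<oplus>\<^bsub>?P\<^esub> y) #>\<^bsub>G\<^esub> g)"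
        unfolding x(2) y(2) ad[OF x(1) y(1)]
        using x(1) y(1) by (intro coset_action[OF assms _ g]) simp
      also have "\<dots> = (?F +>\<^bsub>?P\<^esub> (x #>\<^bsub>G\<^esub> g)) \<oplus>\<^bsub>?Q\<^esub> (?F +>\<^bsub>?P\<^esub> (y #>\<^bsub>G\<^esub> g))"
        unfolding s by (rule ad[OF rc[OF x(1) g] rc[OF y(1) g], symmetric])
      also have "\<dots> = v \<oplus>\<^bsub>?Q\<^esub> w"
        using coset_action[OF assms x(1) g] coset_action[OF assms y(1) g] vw g
        unfolding x(2)[symmetric] y(2)[symmetric] ends_fixed_def by simp
      finally show ?thesis .
    qed
    then show "v \<oplus>\<^bsub>?Q\<^esub> w \<in> ends_fixed G K"
      using Q.a_closed[OF vQ wQ] unfolding ends_fixed_def by simp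
  qed
  then show ?thesis
    using Q.submodule_is_module field_F2 unfolding vectorspace_def by blast
qed


subsection \<open>Median algebras\<close>

locale median_algebra =
  fixes M :: "'m set" and m :: "'m \<Rightarrow> 'm \<Rightarrow> 'm \<Rightarrow> 'm"
  assumes nonempty: "M \<noteq> {}"
    and closed: "\<lbrakk>x \<in> M; y \<in> M; z \<in> M\<rbrakk> \<Longrightarrow> m x y z \<in> M"
    and symmetric: "\<lbrakk>x \<in> M; y \<in> M; z \<in> M\<rbrakk> \<Longrightarrow> m x y z = m x z y \<and> m x y z = m y z x"
    and majority: "\<lbrakk>x \<in> M; y \<in> M\<rbrakk> \<Longrightarrow> m x x y = x"
    and distributive:
      "\<lbrakk>x \<in> M; y \<in> M; z \<in> M; u \<in> M; v \<in> M\<rbrakk>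
       \<Longrightarrow> m (m x y z) u v = m x (m y u v) (m z u v)"

definition median_interval :: "'m set \<Rightarrow> ('m \<Rightarrow> 'm \<Rightarrow> 'm \<Rightarrow> 'm) \<Rightarrow> 'm \<Rightarrow> 'm \<Rightarrow> 'm set" where
  "median_interval M m x y = {z \<in> M. z = m x y z}"

definition median_convex :: "'m set \<Rightarrow> ('m \<Rightarrow> 'm \<Rightarrow> 'm \<Rightarrow> 'm) \<Rightarrow> 'm set \<Rightarrow> bool" where
  "median_convex M m C \<longleftrightarrow> C \<subseteq> M \<and> (\<forall>x\<in>C. \<forall>y\<in>C. median_interval M m x y \<subseteq> C)"

definition half_space :: "'m set \<Rightarrow> ('m \<Rightarrow> 'm \<Rightarrow> 'm \<Rightarrow> 'm) \<Rightarrow> 'm set \<Rightarrow> bool" where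
  "half_space M m H \<longleftrightarrow> H \<subseteq> M \<and> median_convex M m H \<and> median_convex M m (M - H)"

definition separating_half_spaces ::
    "'m set \<Rightarrow> ('m \<Rightarrow> 'm \<Rightarrow> 'm \<Rightarrow> 'm) \<Rightarrow> 'm \<Rightarrow> 'm \<Rightarrow> 'm set set" where
  "separating_half_spaces M m x y = {H. half_space M m H \<and> x \<in> H \<and> y \<notin> H}"

definition median_dist :: "'m set \<Rightarrow> ('m \<Rightarrow> 'm \<Rightarrow> 'm \<Rightarrow> 'm) \<Rightarrow> 'm \<Rightarrow> 'm \<Rightarrow> nat" where
  "median_dist M m x y = card (separating_half_spaces M m x y)"

locale discrete_median_algebra = median_algebra +
  assumes discrete: "\<lbrakk>x \<in> M; y \<in> M\<rbrakk> \<Longrightarrow> finite (separating_half_spaces M m x y)"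

locale median_action = group_action G M \<phi> + median_algebra M m
  for G (structure) and M and m and \<phi> +
  assumes median_preserving:
    "\<lbrakk>g \<in> carrier G; x \<in> M; y \<in> M; z \<in> M\<rbrakk>
     \<Longrightarrow> \<phi> g (m x y z) = m (\<phi> g x) (\<phi> g y) (\<phi> g z)"

definition elliptic_action ::
    "('g, 'r) monoid_scheme \<Rightarrow> 'm set \<Rightarrow> ('m \<Rightarrow> 'm \<Rightarrow> 'm \<Rightarrow> 'm) \<Rightarrow> ('g \<Rightarrow> 'm \<Rightarrow> 'm) \<Rightarrow> bool" where
  "elliptic_action G M m \<phi> \<longleftrightarrow>
     (\<exists>x\<in>M. \<exists>n. \<forall>y\<in>orbit G \<phi> x. \<forall>z\<in>orbit G \<phi> x. median_dist M m y z \<le> n)"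

text \<open>HOL cannot quantify over types inside a formula, so existence of an action is relative to
  the type of the points of the median algebra. To state
  that an action exists, fix a concrete type; to use that one exists, allow an arbitrary type.\<close>

definition admits_non_elliptic_action ::
    "'m itself \<Rightarrow> ('g, 'r) monoid_scheme \<Rightarrow> bool" where
  "admits_non_elliptic_action _ G \<longleftrightarrow>
     (\<exists>(M :: 'm set) m \<phi>. discrete_median_algebra M m \<and> median_action G M m \<phi> \<and>
        \<not> elliptic_action G M m \<phi>)"

end

theory Submission
  imports Defs
begin

text \<open>
  Call a subset \<open>A\<close> of \<open>G\<close> with \<open>K A = A\<close> almost invariant if it differs from each translate \<open>A g\<close> by a
  \<open>K\<close>-finite set. By \<open>ends_gt_1_iff\<close>, more than one end means that there is such an \<open>A\<close> which is
  nontrivial: neither \<open>A\<close> nor its complement is \<open>K\<close>-finite.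

  From a nontrivial almost invariant set \<open>A\<close> one obtains a median algebra whose points are all
  \<open>K\<close>-invariant sets differing from \<open>A\<close> by a \<open>K\<close>-finite set, with the majority vote as median and with \<open>G\<close> acting by right
  translation. Its points are subsets of the coset space that pairwise differ by finitely many cosets,
  which makes it discrete, with distances bounded below by the number of cosets by which two points
  differ in one direction. The action is not elliptic: in a transitive action, a set that differs
  from its translates by a bounded number of points is finite or cofinite
  (\<open>bounded_commensuration\<close>), which for the action on the cosets would make \<open>A\<close> trivial.

  Conversely, let \<open>G\<close> act on a discrete median algebra and fix a point \<open>x\<close>. A half space \<open>H\<close> with
  stabilizer \<open>K\<close> gives the set of all \<open>h\<close> with \<open>h x \<in> H\<close>, which is almost invariant because only
  finitely many translates of \<open>H\<close> separate \<open>x\<close> from \<open>g x\<close>. If this set is trivial, the number of these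
  translates is bounded independently of \<open>g\<close> (\<open>one_end_bounds_separating_translates\<close>). Since \<open>G\<close> is
  finitely generated, the half spaces separating points of the orbit of \<open>x\<close> fall into finitely many
  classes under translation: a path through the orbit from \<open>x\<close> to \<open>g x\<close> crosses only translates of
  walls between \<open>x\<close> and \<open>s x\<close>, with \<open>s\<close> a generator. So if no subgroup has more than one end, the
  orbit is bounded.
\<close>

section \<open>Invariant sets modulo finite sets\<close>

lemma FKG_sym_diff:
  assumes "group G" "subgroup K G" "A \<in> FKG G K" "B \<in> FKG G K"
  shows "sym_diff A B \<in> FKG G K"
  using submodule.m_closed[OF FKG_submodule[OF assms(1,2)] assms(3,4)] by (simp only: PKG_simps)

lemma FKG_mono:
  assumes "group G" "subgroup K G" "B \<in> FKG G K" "A \<subseteq> B" "A \<in> carrier (PKG G K)"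
  shows "A \<in> FKG G K"
proof -
  obtain F where "finite F" "F \<subseteq> carrier G" "B = K <#>\<^bsub>G\<^esub> F" using assms(3) by (auto simp: FKG_def)
  then show ?thesis
    using FKG_subset_closed[OF assms(1,2), of F A] assms(4,5) by (auto simp: FKG_def PKG_simps)
qed

lemma FKG_empty: "{} \<in> FKG G K"
  unfolding FKG_def by (auto simp: set_mult_def intro!: exI[of _ "{}"])

lemma PKG_sym_diff:
  assumes "group G" "subgroup K G" "A \<in> carrier (PKG G K)" "B \<in> carrier (PKG G K)"
  shows "sym_diff A B \<in> carrier (PKG G K)"
  using PKG_diff[OF assms(1,2), of A B] assms(3,4) by (auto simp: PKG_simps)

lemma PKG_carrier:
  assumes "group G" "subgroup K G"
  shows "carrier G \<in> carrier (PKG G K)"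
proof -
  interpret group G by fact
  interpret K: subgroup K G by fact
  show ?thesis unfolding PKG_simps mem_Collect_eq PKG_closed[OF assms subset_refl] by simp
qed

lemma FKG_Un:
  assumes "A \<in> FKG G K" "B \<in> FKG G K"
  shows "A \<union> B \<in> FKG G K"
proof -
  obtain E F where "finite E" "E \<subseteq> carrier G" "A = K <#>\<^bsub>G\<^esub> E" "finite F" "F \<subseteq> carrier G" "B = K <#>\<^bsub>G\<^esub> F"
    using assms by (auto simp: FKG_def)
  then show ?thesis
    unfolding FKG_def by (auto simp: set_mult_def intro!: exI[of _ "E \<union> F"])
qed

text \<open>The form in which \<open>K\<close>-finiteness is verified below: it suffices to map \<open>D\<close> to a finite set by a
  function whose fibres each lie in a single right coset of \<open>K\<close>.\<close>

lemma FKG_if_finite_image: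
  assumes "group G" "subgroup K G" "D \<in> carrier (PKG G K)" "finite (f ` D)"
    and same: "\<And>g h. g \<in> D \<Longrightarrow> h \<in> D \<Longrightarrow> f g = f h \<Longrightarrow> g \<in> K #>\<^bsub>G\<^esub> h"
  shows "D \<in> FKG G K"
proof -
  have D: "D \<subseteq> carrier G" using assms(3) by (simp add: PKG_simps)
  obtain F where F: "F \<subseteq> D" "finite F" "f ` D = f ` F"
    using finite_subset_image[OF assms(4) subset_refl] by blast
  have "D \<subseteq> K <#>\<^bsub>G\<^esub> F"
  proof
    fix g assume g: "g \<in> D"
    then obtain h where "h \<in> F" "f g = f h" using F(3) by blast
    then have "g \<in> K #>\<^bsub>G\<^esub> h" using same g F(1) by blast
    then show "g \<in> K <#>\<^bsub>G\<^esub> F" using \<open>h \<in> F\<close> unfolding r_coset_def set_mult_def by blast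
  qed
  moreover have "K <#>\<^bsub>G\<^esub> F \<in> FKG G K" using F D unfolding FKG_def by blast
  ultimately show ?thesis using FKG_mono[OF assms(1,2)] assms(3) by blast
qed

lemma PKG_mem_iff:
  assumes "group G" "subgroup K G" "B \<in> carrier (PKG G K)" "k \<in> K" "a \<in> carrier G"
  shows "k \<otimes>\<^bsub>G\<^esub> a \<in> B \<longleftrightarrow> a \<in> B"
proof -
  interpret group G by fact
  interpret K: subgroup K G by fact
  have cl: "\<forall>k\<in>K. \<forall>a\<in>B. k \<otimes>\<^bsub>G\<^esub> a \<in> B"
    using PKG_closed[OF assms(1,2), of B] assms(3) by (auto simp: PKG_simps)
  show ?thesis
  proof
    assume "k \<otimes>\<^bsub>G\<^esub> a \<in> B"
    then have "inv\<^bsub>G\<^esub> k \<otimes>\<^bsub>G\<^esub> (k \<otimes>\<^bsub>G\<^esub> a) \<in> B" using cl assms(4) by blast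
    then show "a \<in> B" using assms(4,5) by (simp add: m_assoc[symmetric])
  qed (use cl assms(4) in blast)
qed

lemma PKG_coset_subset_iff:
  assumes "group G" "subgroup K G" "B \<in> carrier (PKG G K)" "a \<in> carrier G"
  shows "K #>\<^bsub>G\<^esub> a \<subseteq> B \<longleftrightarrow> a \<in> B"
proof -
  interpret group G by fact
  interpret K: subgroup K G by fact
  show ?thesis
    using PKG_mem_iff[OF assms(1-3) _ assms(4)] rcos_self[OF assms(4,2)]
    unfolding r_coset_def by blast
qed

lemma PKG_I:
  assumes "group G" "subgroup K G" "B \<subseteq> carrier G"
    and "\<And>k a. k \<in> K \<Longrightarrow> a \<in> carrier G \<Longrightarrow> a \<in> B \<Longrightarrow> k \<otimes>\<^bsub>G\<^esub> a \<in> B"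
  shows "B \<in> carrier (PKG G K)"
  using assms PKG_closed[OF assms(1-3)] by (auto simp: PKG_simps)

section \<open>More than one end\<close>

text \<open>Over the field with two elements, a space of dimension at most one has no vectors besides
  \<open>0\<close> and one further vector \<open>v\<close>: the set \<open>{0, v}\<close> is closed under addition because \<open>v + v = 0\<close>.\<close>

lemma edim_F2_gt_1_iff:
  assumes "vectorspace F2 V"
  shows "edim F2 V > 1 \<longleftrightarrow> \<not> (\<exists>v. carrier V \<subseteq> {\<zero>\<^bsub>V\<^esub>, v})"
proof
  interpret vectorspace F2 V by fact
  assume gt: "edim F2 V > 1"
  show "\<not> (\<exists>v. carrier V \<subseteq> {\<zero>\<^bsub>V\<^esub>, v})"
  proof
    assume "\<exists>v. carrier V \<subseteq> {\<zero>\<^bsub>V\<^esub>, v}"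
    then obtain v where v: "v \<in> carrier V" "carrier V \<subseteq> {\<zero>\<^bsub>V\<^esub>, v}"
      using M.zero_closed by blast
    have "carrier V \<subseteq> span {v}"
      using v in_own_span[of "{v}"] submodule.zero_closed[OF span_is_submodule[of "{v}"]] by auto
    then have gen: "gen_set {v}"
      using span_is_subset2[of "{v}"] v by auto
    then have "fin_dim" "dim \<le> 1"
      using v dim_le1I unfolding fin_dim_def by blast+
    then show False using gt unfolding edim_def by (simp add: one_enat_def)
  qed
next
  interpret vectorspace F2 V by fact
  assume *: "\<not> (\<exists>v. carrier V \<subseteq> {\<zero>\<^bsub>V\<^esub>, v})"
  show "edim F2 V > 1"
  proof (rule ccontr)
    assume "\<not> edim F2 V > 1"
    then have fd: "fin_dim" and d1: "dim \<le> 1"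
      by (auto simp: edim_def one_enat_def split: if_splits)
    obtain b where b: "finite b" "basis b" using finite_basis_exists[OF fd] by blast
    have bV: "b \<subseteq> carrier V" and gen: "span b = carrier V" using b(2) unfolding basis_def by auto
    have cb: "card b \<le> 1" using dim_basis[OF b] d1 by simp
    obtain v where v: "v \<in> carrier V" "b \<subseteq> {v}"
    proof (cases "b = {}")
      case True
      then show ?thesis using that[of "\<zero>\<^bsub>V\<^esub>"] by simp
    next
      case False
      then have "card b = 1" using b(1) cb by (simp add: le_Suc_eq)
      then obtain w where "b = {w}" by (rule card_1_singletonE)
      then show ?thesis using that[of w] bV by simp
    qed
    have vv: "v \<oplus>\<^bsub>V\<^esub> v = \<zero>\<^bsub>V\<^esub>"
    proof -
      have "v \<oplus>\<^bsub>V\<^esub> v = (\<one>\<^bsub>F2\<^esub> \<oplus>\<^bsub>F2\<^esub> \<one>\<^bsub>F2\<^esub>) \<odot>\<^bsub>V\<^esub> v"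
        using v by (subst smult_l_distr) auto
      also have "\<one>\<^bsub>F2\<^esub> \<oplus>\<^bsub>F2\<^esub> \<one>\<^bsub>F2\<^esub> = \<zero>\<^bsub>F2\<^esub>" by (simp add: residue_ring_def)
      finally show ?thesis using v by simp
    qed
    have "submodule F2 {\<zero>\<^bsub>V\<^esub>, v} V"
    proof (rule submodule.intro)
      show "module F2 V" by unfold_locales
      show "c \<odot>\<^bsub>V\<^esub> x \<in> {\<zero>\<^bsub>V\<^esub>, v}" if "c \<in> carrier F2" "x \<in> {\<zero>\<^bsub>V\<^esub>, v}" for c x
      proof -
        have "c = 0 \<or> c = 1" using that(1) by (auto simp: residue_ring_def)
        then have "c = \<zero>\<^bsub>F2\<^esub> \<or> c = \<one>\<^bsub>F2\<^esub>" by (auto simp: residue_ring_def)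
        then show ?thesis using that(2) v by auto
      qed
    qed (use v vv in auto)
    then have "span b \<subseteq> {\<zero>\<^bsub>V\<^esub>, v}" using v by (intro span_is_subset) auto
    then show False using gen * by blast
  qed
qed

lemma FKG_class_eq_iff:
  assumes "group G" "subgroup K G" "A \<in> carrier (PKG G K)" "B \<in> carrier (PKG G K)"
  shows "FKG G K +>\<^bsub>PKG G K\<^esub> A = FKG G K +>\<^bsub>PKG G K\<^esub> B \<longleftrightarrow> sym_diff A B \<in> FKG G K"
proof -
  interpret abelian_subgroup "FKG G K" "PKG G K"
    by (rule submodule_abelian_subgroup[OF PKG_module[OF assms(1,2)] FKG_submodule[OF assms(1,2)]])
  have mem: "C \<in> FKG G K +>\<^bsub>PKG G K\<^esub> B \<longleftrightarrow> sym_diff C B \<in> FKG G K" for C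
  proof
    assume "sym_diff C B \<in> FKG G K"
    moreover have "C = sym_diff (sym_diff C B) B" by blast
    ultimately show "C \<in> FKG G K +>\<^bsub>PKG G K\<^esub> B" unfolding a_r_coset_def' PKG_simps by blast
  next
    assume "C \<in> FKG G K +>\<^bsub>PKG G K\<^esub> B"
    then obtain F where "F \<in> FKG G K" "C = sym_diff F B" unfolding a_r_coset_def' PKG_simps by blast
    moreover have "sym_diff (sym_diff F B) B = F" by blast
    ultimately show "sym_diff C B \<in> FKG G K" by simp
  qed
  show ?thesis
    using a_repr_independence'[of A B] a_rcos_self[OF assms(3)] assms mem[of A] by auto
qed

text \<open>The classes of \<open>{}\<close> and of \<open>G\<close> are always fixed by \<open>G\<close>. More than one end therefore means that
  some fixed class differs from both, or in terms of a representative \<open>A\<close>: all \<open>A g\<close> differ from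
  \<open>A\<close> by a \<open>K\<close>-finite set, but neither \<open>A\<close> nor its complement is \<open>K\<close>-finite. Such an \<open>A\<close> also
  keeps the classes of \<open>{}\<close> and of \<open>G\<close> apart: if \<open>G\<close> is \<open>K\<close>-finite, so are all its \<open>K\<close>-invariant
  subsets.\<close>

lemma ends_gt_1_iff:
  assumes "group G" "subgroup K G"
  shows "ends G K > 1 \<longleftrightarrow>
    (\<exists>A \<in> carrier (PKG G K). A \<notin> FKG G K \<and> carrier G - A \<notin> FKG G K
       \<and> (\<forall>g\<in>carrier G. sym_diff A (A #>\<^bsub>G\<^esub> g) \<in> FKG G K))"
    (is "_ \<longleftrightarrow> (\<exists>A \<in> carrier ?P. ?R A)")
proof -
  interpret group G by fact
  interpret K: subgroup K G by fact
  let ?F = "FKG G K"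
  let ?c = "\<lambda>A. ?F +>\<^bsub>?P\<^esub> A"
  note eq = FKG_class_eq_iff[OF assms]
  have zP: "{} \<in> carrier ?P" by (auto simp: PKG_simps set_mult_def)
  have GP: "carrier G \<in> carrier ?P" by (rule PKG_carrier[OF assms])
  have c0: "?c {} = ?F" by (simp add: a_r_coset_def' PKG_simps)
  have AgP: "A #>\<^bsub>G\<^esub> g \<in> carrier ?P" if A: "A \<in> carrier ?P" and g: "g \<in> carrier G" for A g
    using setmult_rcos_assoc[OF K.subset _ g, of A] r_coset_subset_G[of A g] A g by (simp add: PKG_simps)
  have fixed: "ends_fixed G K = ?c ` {A \<in> carrier ?P. \<forall>g\<in>carrier G. sym_diff A (A #>\<^bsub>G\<^esub> g) \<in> ?F}"
  proof -
    have fx: "(\<forall>g\<in>carrier G. (\<lambda>B. B #>\<^bsub>G\<^esub> g) ` ?c A = ?c A) \<longleftrightarrow>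
        (\<forall>g\<in>carrier G. sym_diff A (A #>\<^bsub>G\<^esub> g) \<in> ?F)" if "A \<in> carrier ?P" for A
    proof (intro ball_cong refl)
      fix g assume g: "g \<in> carrier G"
      show "(\<lambda>B. B #>\<^bsub>G\<^esub> g) ` ?c A = ?c A \<longleftrightarrow> sym_diff A (A #>\<^bsub>G\<^esub> g) \<in> ?F"
        unfolding coset_action[OF assms that g] eq[OF that AgP[OF that g], symmetric]
        by (rule eq_commute)
    qed
    have "carrier (quotient_module ?P ?F) = ?c ` carrier ?P"
      by (auto simp: quotient_module_def A_RCOSETS_def')
    then have "ends_fixed G K = {S \<in> ?c ` carrier ?P. \<forall>g\<in>carrier G. (\<lambda>B. B #>\<^bsub>G\<^esub> g) ` S = S}"
      by (simp only: ends_fixed_def)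
    also have "\<dots> = ?c ` {A \<in> carrier ?P. \<forall>g\<in>carrier G. (\<lambda>B. B #>\<^bsub>G\<^esub> g) ` ?c A = ?c A}"
      unfolding image_def by blast
    also have "{A \<in> carrier ?P. \<forall>g\<in>carrier G. (\<lambda>B. B #>\<^bsub>G\<^esub> g) ` ?c A = ?c A} =
        {A \<in> carrier ?P. \<forall>g\<in>carrier G. sym_diff A (A #>\<^bsub>G\<^esub> g) \<in> ?F}"
      using fx by (intro Collect_cong conj_cong refl)
    finally show ?thesis .
  qed
  have "ends G K > 1 \<longleftrightarrow> \<not> (\<exists>v. ends_fixed G K \<subseteq> {?F, v})"
    unfolding ends_def using edim_F2_gt_1_iff[OF ends_vectorspace[OF assms]]
    by (simp add: quotient_module_def)
  also have "\<dots> \<longleftrightarrow> (\<exists>A \<in> carrier ?P. ?R A)"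
  proof
    assume "\<not> (\<exists>v. ends_fixed G K \<subseteq> {?F, v})"
    then have "\<not> ends_fixed G K \<subseteq> {?F, ?c (carrier G)}" by blast
    then obtain A where A: "A \<in> carrier ?P" "\<forall>g\<in>carrier G. sym_diff A (A #>\<^bsub>G\<^esub> g) \<in> ?F"
      "?c A \<noteq> ?c {}" "?c A \<noteq> ?c (carrier G)" unfolding fixed c0 by blast
    have "sym_diff A (carrier G) = carrier G - A" "sym_diff A {} = A"
      using A(1) by (auto simp: PKG_simps)
    then have "?R A" using A eq[OF A(1) zP] eq[OF A(1) GP] by simp
    then show "\<exists>A \<in> carrier ?P. ?R A" using A(1) by blast
  next
    assume "\<exists>A \<in> carrier ?P. ?R A"
    then obtain A where A: "A \<in> carrier ?P" "?R A" by blast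
    have "sym_diff A (carrier G) = carrier G - A" "sym_diff A {} = A"
      using A(1) by (auto simp: PKG_simps)
    then have ne: "?c A \<noteq> ?F" "?c A \<noteq> ?c (carrier G)"
      using A eq[OF A(1) zP] eq[OF A(1) GP] c0 by simp_all
    have "carrier G \<notin> ?F"
      using FKG_mono[OF assms, of "carrier G" A] A by (auto simp: PKG_simps)
    then have ne': "?c (carrier G) \<noteq> ?F" using eq[OF GP zP] c0 by simp
    have "sym_diff (carrier G) (carrier G #>\<^bsub>G\<^esub> g) \<in> ?F" if "g \<in> carrier G" for g
      using that FKG_empty coset_join2[OF that subgroup_self that] by simp
    then have "?c A \<in> ends_fixed G K" "?c (carrier G) \<in> ends_fixed G K"
      using A GP unfolding fixed by blast+
    then show "\<not> (\<exists>v. ends_fixed G K \<subseteq> {?F, v})" using ne ne' by blast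
  qed
  finally show ?thesis .
qed

section \<open>Sets boundedly commensurated by a transitive action\<close>

lemma large_set_forces_small_value:
  fixes h :: "'x \<Rightarrow> real"
  assumes "\<And>Y. finite Y \<Longrightarrow> Y \<subseteq> X \<Longrightarrow> (\<Sum>x\<in>Y. (h x)\<^sup>2) \<le> r" "Z \<subseteq> X" "infinite Z"
  shows "\<exists>x\<in>Z. \<bar>h x\<bar> \<le> 1/4"
proof (rule ccontr)
  assume "\<not> ?thesis"
  then have big: "1/16 \<le> (h x)\<^sup>2" if "x \<in> Z" for x
    using that power_mono[of "1/4" "\<bar>h x\<bar>" 2] by (force simp: power2_eq_square)
  obtain n :: nat where n: "real n * (1/16) > r"
    using reals_Archimedean3[of "1/16"] by auto
  obtain Y where Y: "finite Y" "card Y = n" "Y \<subseteq> Z"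
    using infinite_arbitrarily_large[OF assms(3)] by blast
  have "real n * (1/16) = (\<Sum>x\<in>Y. 1/16)" using Y by simp
  also have "\<dots> \<le> (\<Sum>x\<in>Y. (h x)\<^sup>2)" using Y big by (intro sum_mono) auto
  also have "\<dots> \<le> r" using assms(1,2) Y by blast
  finally show False using n by simp
qed

text \<open>An argument with circumcentres in \<open>\<ell>\<^sup>2\<close>, cut down to finitely many steps. The indicator functions
  of the translates of \<open>A\<close> have bounded mutual distance. Let \<open>f\<close> be a function within squared
  distance \<open>r\<close> of all of them. If \<open>A\<close> and its complement are infinite, then \<open>f\<close> is close to \<open>1\<close> at some
  point \<open>a\<close> of \<open>A\<close> and close to \<open>0\<close> at some point \<open>b\<close> outside \<open>A\<close>. Transitivity moves \<open>a\<close> to \<open>b\<close>,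
  so \<open>f\<close> differs substantially from one of its translates, for which the same \<open>r\<close> works because the
  orbit is invariant. By the parallelogram law \<open>r\<close> can be lowered by a fixed amount for the midpoint
  of the two. Repeating this makes \<open>r\<close> negative, which is absurd. Distances are expressed by partial
  sums over finite sets of points, so no summability has to be checked.\<close>

lemma (in transitive_action) bounded_commensuration:
  assumes AE: "A \<subseteq> E"
    and bounded: "\<And>g. g \<in> carrier G \<Longrightarrow>
      finite (sym_diff (\<phi> g ` A) A) \<and> card (sym_diff (\<phi> g ` A) A) \<le> n"
  shows "finite A \<or> finite (E - A)"
proof (rule ccontr)
  assume "\<not> (finite A \<or> finite (E - A))"
  then have inf: "infinite A" "infinite (E - A)" by auto
  interpret group G using group_hom group_hom.axioms(1) by auto
  define \<chi> :: "'c set \<Rightarrow> 'c \<Rightarrow> real" where "\<chi> C x = of_bool (x \<in> C)" for C x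
  define near where "near f r \<longleftrightarrow> (\<forall>g\<in>carrier G. \<forall>Y. finite Y \<longrightarrow> Y \<subseteq> E \<longrightarrow>
      (\<Sum>x\<in>Y. (f x - \<chi> (\<phi> g ` A) x)\<^sup>2) \<le> r)" for f :: "'c \<Rightarrow> real" and r :: real
  have start: "near (\<chi> A) n"
    unfolding near_def
  proof (intro ballI allI impI)
    fix g Y assume g: "g \<in> carrier G" and Y: "finite Y" "Y \<subseteq> E"
    let ?D = "sym_diff (\<phi> g ` A) A"
    have "(\<Sum>x\<in>Y. (\<chi> A x - \<chi> (\<phi> g ` A) x)\<^sup>2) = (\<Sum>x\<in>Y \<inter> ?D. 1)"
      using Y by (intro sum.mono_neutral_cong_right) (auto simp: \<chi>_def)
    also have "\<dots> = real (card (Y \<inter> ?D))" by simp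
    also have "\<dots> \<le> real (card ?D)"
      using bounded[OF g] by (intro of_nat_mono card_mono) auto
    also have "\<dots> \<le> n" using bounded[OF g] by simp
    finally show "(\<Sum>x\<in>Y. (\<chi> A x - \<chi> (\<phi> g ` A) x)\<^sup>2) \<le> n" .
  qed
  have improve: "\<exists>f'. near f' (r - 1/16)" if f: "near f r" for f r
  proof -
    have one: "\<phi> \<one> ` A = A" 
      using AE by (auto simp: id_eq_one[symmetric] subset_iff image_iff)
    have fA: "(\<Sum>x\<in>Y. (f x - \<chi> A x)\<^sup>2) \<le> r" if "finite Y" "Y \<subseteq> E" for Y
      using f that one one_closed unfolding near_def by metis
    obtain a where a: "a \<in> A" "\<bar>f a - 1\<bar> \<le> 1/4"
      using large_set_forces_small_value[OF fA AE inf(1)] by (auto simp: \<chi>_def)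
    obtain b where b: "b \<in> E" "\<bar>f b\<bar> \<le> 1/4"
      using large_set_forces_small_value[OF fA _ inf(2)] by (auto simp: \<chi>_def)
    obtain h where h: "h \<in> carrier G" "\<phi> h a = b" using unique_orbit a b AE by blast
    \<comment> \<open>The midpoint of \<open>f\<close> and its translate.\<close>
    define f' where "f' x = (f x + f (\<phi> h x)) / 2" for x
    have "near f' (r - 1/16)"
      unfolding near_def
    proof (intro ballI allI impI)
      fix g Y assume g: "g \<in> carrier G" and "finite Y" "Y \<subseteq> E"
      \<comment> \<open>The gain comes from the point \<open>a\<close> alone, so \<open>a\<close> has to be among the summation points.\<close>
      define Z where "Z = insert a Y"
      have Z: "finite Z" "Z \<subseteq> E" using \<open>finite Y\<close> \<open>Y \<subseteq> E\<close> a AE by (auto simp: Z_def)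
      let ?C = "\<phi> g ` A"
      have C: "?C \<subseteq> E" using surj_prop[OF g] AE by blast
      have hC: "\<phi> (h \<otimes> g) ` A = \<phi> h ` ?C"
        
        using AE by (auto simp: image_image composition_rule[OF _ h(1) g] subset_iff intro!: image_cong)
      have s1: "(\<Sum>x\<in>Z. (f x - \<chi> ?C x)\<^sup>2) \<le> r" using f g Z unfolding near_def by blast
      have inj: "inj_on (\<phi> h) E" by (rule inj_prop[OF h(1)])
      have "(\<Sum>x\<in>Z. (f (\<phi> h x) - \<chi> ?C x)\<^sup>2) = (\<Sum>x\<in>Z. (f (\<phi> h x) - \<chi> (\<phi> (h \<otimes> g) ` A) (\<phi> h x))\<^sup>2)"
        unfolding hC \<chi>_def using inj_on_image_mem_iff[OF inj _ C] Z by (intro sum.cong) auto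
      also have "\<dots> = (\<Sum>y\<in>\<phi> h ` Z. (f y - \<chi> (\<phi> (h \<otimes> g) ` A) y)\<^sup>2)"
        using inj_on_subset[OF inj Z(2)] by (simp add: sum.reindex)
      also have "\<dots> \<le> r"
      proof -
        have "\<phi> h ` Z \<subseteq> E" using surj_prop[OF h(1)] Z by blast
        then show ?thesis
          by (rule f[unfolded near_def, rule_format, OF m_closed[OF h(1) g] finite_imageI[OF Z(1)]])
      qed
      finally have s2: "(\<Sum>x\<in>Z. (f (\<phi> h x) - \<chi> ?C x)\<^sup>2) \<le> r" .
      \<comment> \<open>At \<open>a\<close> the function is at least \<open>3/4\<close>, its translate at most \<open>1/4\<close>.\<close>
      have "1/4 \<le> (f a - f (\<phi> h a)) / 2"
        using abs_le_D2[OF a(2)] abs_le_D1[OF b(2)] unfolding h(2) by (simp add: field_simps)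
      then have "1/16 \<le> ((f a - f (\<phi> h a)) / 2)\<^sup>2"
        using power_mono[of "1/4" "(f a - f (\<phi> h a)) / 2" 2] by (simp add: power2_eq_square)
      also have "\<dots> \<le> (\<Sum>x\<in>Z. ((f x - f (\<phi> h x)) / 2)\<^sup>2)"
        using Z by (intro member_le_sum) (auto simp: Z_def)
      finally have s3: "1/16 \<le> (\<Sum>x\<in>Z. ((f x - f (\<phi> h x)) / 2)\<^sup>2)" .
      have "(\<Sum>x\<in>Y. (f' x - \<chi> ?C x)\<^sup>2) \<le> (\<Sum>x\<in>Z. (f' x - \<chi> ?C x)\<^sup>2)"
        using Z by (intro sum_mono2) (auto simp: Z_def)
      also have "\<dots> = (\<Sum>x\<in>Z. (1/2) * (f x - \<chi> ?C x)\<^sup>2 + (1/2) * (f (\<phi> h x) - \<chi> ?C x)\<^sup>2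
          - ((f x - f (\<phi> h x)) / 2)\<^sup>2)"
        by (intro sum.cong refl) (simp add: f'_def power2_eq_square field_simps)
      also have "\<dots> = (1/2) * (\<Sum>x\<in>Z. (f x - \<chi> ?C x)\<^sup>2) + (1/2) * (\<Sum>x\<in>Z. (f (\<phi> h x) - \<chi> ?C x)\<^sup>2)
          - (\<Sum>x\<in>Z. ((f x - f (\<phi> h x)) / 2)\<^sup>2)"
        by (simp only: sum.distrib sum_subtractf sum_distrib_left)
      also have "\<dots> \<le> r - 1/16" using s1 s2 s3 by simp
      finally show "(\<Sum>x\<in>Y. (f' x - \<chi> ?C x)\<^sup>2) \<le> r - 1/16" .
    qed
    then show ?thesis by blast
  qed
  have "\<exists>f. near f (n - real k / 16)" for k
  proof (induction k)
    case 0 then show ?case using start by auto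
  next
    case (Suc k)
    then obtain f where "near f (n - real k / 16)" by blast
    from improve[OF this] show ?case by (simp add: add_divide_distrib diff_diff_eq add.commute)
  qed
  \<comment> \<open>After more than \<open>16 n\<close> steps even the empty sum, which is \<open>0\<close>, exceeds the bound.\<close>
  then obtain f where "near f (n - real (16 * n + 16) / 16)" by blast
  then have "(\<Sum>x\<in>{}. (f x - \<chi> (\<phi> \<one> ` A) x)\<^sup>2) \<le> n - real (16 * n + 16) / 16"
    unfolding near_def using one_closed by blast
  then show False by simp
qed


section \<open>Translation actions on sets of subsets\<close>

text \<open>The inverse turns translation from the right into an action from the left.\<close>

lemma right_translation_action:
  assumes "group G" and sub: "\<And>B. B \<in> X \<Longrightarrow> B \<subseteq> carrier G"
    and inv: "\<And>B g. B \<in> X \<Longrightarrow> g \<in> carrier G \<Longrightarrow> B #>\<^bsub>G\<^esub> g \<in> X"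
  shows "group_action G X (\<lambda>g. \<lambda>B\<in>X. B #>\<^bsub>G\<^esub> inv\<^bsub>G\<^esub> g)"
proof -
  interpret group G by fact
  let ?\<phi> = "\<lambda>g. \<lambda>B\<in>X. B #>\<^bsub>G\<^esub> inv\<^bsub>G\<^esub> g"
  have Bij: "?\<phi> g \<in> Bij X" if g: "g \<in> carrier G" for g
  proof -
    have "bij_betw (\<lambda>B. B #>\<^bsub>G\<^esub> inv\<^bsub>G\<^esub> g) X X"
      using g sub inv
      by (intro bij_betw_byWitness[where f' = "\<lambda>B. B #>\<^bsub>G\<^esub> g"])
        (auto simp: coset_mult_assoc coset_mult_one simp del: coset_mult_inv1)
    then have "bij_betw (?\<phi> g) X X" by (simp cong: bij_betw_cong)
    then show ?thesis by (simp add: Bij_def)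
  qed
  show ?thesis
  proof (intro group_action.intro group_hom.intro group_hom_axioms.intro homI)
    show "?\<phi> (g \<otimes>\<^bsub>G\<^esub> h) = ?\<phi> g \<otimes>\<^bsub>BijGroup X\<^esub> ?\<phi> h"
      if g: "g \<in> carrier G" and h: "h \<in> carrier G" for g h
    proof -
      have "?\<phi> g \<otimes>\<^bsub>BijGroup X\<^esub> ?\<phi> h = compose X (?\<phi> g) (?\<phi> h)"
        using Bij[OF g] Bij[OF h] by (simp add: BijGroup_def)
      also have "\<dots> = ?\<phi> (g \<otimes>\<^bsub>G\<^esub> h)"
        using g h inv sub
        by (intro ext) (simp add: compose_def coset_mult_assoc inv_mult_group)
      finally show ?thesis ..
    qed
  qed (use Bij group_BijGroup in \<open>auto simp: BijGroup_def\<close>)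
qed

lemma coset_action_transitive:
  assumes "group G" "subgroup K G"
  shows "transitive_action G (rcosets\<^bsub>G\<^esub> K) (\<lambda>g. \<lambda>c\<in>rcosets\<^bsub>G\<^esub> K. c #>\<^bsub>G\<^esub> inv\<^bsub>G\<^esub> g)"
proof -
  interpret group G by fact
  interpret K: subgroup K G by fact
  have mult: "(K #>\<^bsub>G\<^esub> a) #>\<^bsub>G\<^esub> g = K #>\<^bsub>G\<^esub> (a \<otimes>\<^bsub>G\<^esub> g)" if "a \<in> carrier G" "g \<in> carrier G" for a g
    using that by (simp add: coset_mult_assoc[OF K.subset])
  show ?thesis
  proof (intro transitive_action.intro transitive_action_axioms.intro right_translation_action)
    show "group G" by fact
    show "B \<subseteq> carrier G" if "B \<in> rcosets\<^bsub>G\<^esub> K" for B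
      using that rcosets_subset_PowG[OF assms(2)] by blast
    show "B #>\<^bsub>G\<^esub> g \<in> rcosets\<^bsub>G\<^esub> K" if "B \<in> rcosets\<^bsub>G\<^esub> K" "g \<in> carrier G" for B g
      using that mult by (auto simp: RCOSETS_def)
    fix x y assume x: "x \<in> rcosets\<^bsub>G\<^esub> K" and y: "y \<in> rcosets\<^bsub>G\<^esub> K"
    then obtain a b where ab: "a \<in> carrier G" "x = K #>\<^bsub>G\<^esub> a" "b \<in> carrier G" "y = K #>\<^bsub>G\<^esub> b"
      by (auto simp: RCOSETS_def)
    have "a \<otimes>\<^bsub>G\<^esub> inv\<^bsub>G\<^esub> (inv\<^bsub>G\<^esub> b \<otimes>\<^bsub>G\<^esub> a) = b"
      using ab by (simp add: inv_mult_group m_assoc[symmetric])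
    then show "\<exists>g\<in>carrier G. (\<lambda>c\<in>rcosets\<^bsub>G\<^esub> K. c #>\<^bsub>G\<^esub> inv\<^bsub>G\<^esub> g) x = y"
      using ab x mult by (intro bexI[of _ "inv\<^bsub>G\<^esub> b \<otimes>\<^bsub>G\<^esub> a"]) auto
  qed
qed

section \<open>Half spaces and intervals\<close>

context median_algebra
begin

text \<open>By symmetry one claim suffices; it is distributivity applied to \<open>m (m y z x) x z\<close>.\<close>

lemma m_in_interval:
  assumes "x \<in> M" "y \<in> M" "z \<in> M"
  shows "m x y z \<in> median_interval M m x y" "m x y z \<in> median_interval M m x z"
    "m x y z \<in> median_interval M m y z"
proof -
  have *: "m x y z \<in> median_interval M m x z" if "x \<in> M" "y \<in> M" "z \<in> M" for x y z
  proof -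
    have "m x z (m x y z) = m (m y z x) x z" using that closed symmetric by metis
    also have "\<dots> = m y (m z x z) (m x x z)" using that by (intro distributive) auto
    also have "\<dots> = m x y z" using that symmetric majority by metis
    finally show ?thesis using that closed by (simp add: median_interval_def)
  qed
  show "m x y z \<in> median_interval M m x z" by (rule *[OF assms])
  show "m x y z \<in> median_interval M m x y"
    using *[of x z y] symmetric[OF assms] assms by simp
  show "m x y z \<in> median_interval M m y z"
    using *[of y x z] symmetric assms by metis
qed

text \<open>The gate map \<open>z \<mapsto> m x y z\<close> onto the interval neither enters nor leaves \<open>H\<close>: the image of \<open>z\<close> lies
  between \<open>z\<close> and \<open>x\<close> as well as between \<open>z\<close> and \<open>y\<close>, and both \<open>H\<close> and its complement are convex.\<close>

lemma half_space_determined_by_interval: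
  assumes "H \<in> separating_half_spaces M m x y" "x \<in> M" "y \<in> M"
  shows "H = {z \<in> M. m x y z \<in> H \<inter> median_interval M m x y}"
proof -
  have H: "H \<subseteq> M" "median_convex M m H" "median_convex M m (M - H)" "x \<in> H" "y \<notin> H"
    using assms(1) by (auto simp: separating_half_spaces_def half_space_def)
  have "z \<in> H \<longleftrightarrow> m x y z \<in> H" if z: "z \<in> M" for z
  proof
    assume "z \<in> H"
    then show "m x y z \<in> H"
      using H m_in_interval(2)[OF assms(2,3) z] unfolding median_convex_def by blast
  next
    assume in_H: "m x y z \<in> H"
    show "z \<in> H"
    proof (rule ccontr)
      assume "z \<notin> H"
      then have "m x y z \<in> M - H"
        using H z assms(3) m_in_interval(3)[OF assms(2,3) z] unfolding median_convex_def by blast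
      then show False using in_H by blast
    qed
  qed
  then show ?thesis using H(1) m_in_interval(1)[OF assms(2,3)] by blast
qed

lemma finite_interval_imp_finite_separating:
  assumes "x \<in> M" "y \<in> M" "finite (median_interval M m x y)"
  shows "finite (separating_half_spaces M m x y)"
proof -
  have "separating_half_spaces M m x y \<subseteq>
      (\<lambda>I. {z \<in> M. m x y z \<in> I}) ` Pow (median_interval M m x y)"
    using half_space_determined_by_interval[OF _ assms(1,2)] by blast
  then show ?thesis using assms(3) finite_subset by blast
qed

end

text \<open>The median of the power set algebra, coordinatewise the majority vote.\<close>

definition set_majority :: "'a set \<Rightarrow> 'a set \<Rightarrow> 'a set \<Rightarrow> 'a set" where
  "set_majority x y z = (x \<inter> y) \<union> (y \<inter> z) \<union> (x \<inter> z)"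

lemma median_algebra_of_sets:
  assumes "S \<noteq> {}" "\<And>x y z. x \<in> S \<Longrightarrow> y \<in> S \<Longrightarrow> z \<in> S \<Longrightarrow> set_majority x y z \<in> S"
  shows "median_algebra S set_majority"
  by unfold_locales (use assms in \<open>auto simp: set_majority_def\<close>)

lemma median_interval_of_sets:
  "median_interval S set_majority x y = {z \<in> S. x \<inter> y \<subseteq> z \<and> z \<subseteq> x \<union> y}"
  unfolding median_interval_def set_majority_def by blast

lemma half_space_of_point: "half_space S set_majority {B \<in> S. a \<in> B}"
  unfolding half_space_def median_convex_def median_interval_of_sets by blast

section \<open>The median algebra of an almost invariant set\<close>

text \<open>The coset of \<open>A\<close> modulo the \<open>K\<close>-finite sets. If that coset is fixed by \<open>G\<close>, it is the median algebra
  on which \<open>G\<close> acts; its points are subsets of the group.\<close>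

definition almost_equality_class :: "('g, 'r) monoid_scheme \<Rightarrow> 'g set \<Rightarrow> 'g set \<Rightarrow> 'g set set" where
  "almost_equality_class G K A = {B \<in> carrier (PKG G K). sym_diff A B \<in> FKG G K}"

text \<open>A left \<open>K\<close>-invariant set \<open>B\<close>, regarded as a subset of the space of right cosets.\<close>

definition cosets_within :: "('g, 'r) monoid_scheme \<Rightarrow> 'g set \<Rightarrow> 'g set \<Rightarrow> 'g set set" where
  "cosets_within G K B = {c \<in> rcosets\<^bsub>G\<^esub> K. c \<subseteq> B}"

lemma FKG_if_finite_cosets_within:
  assumes "group G" "subgroup K G" "B \<in> carrier (PKG G K)" "finite (cosets_within G K B)"
  shows "B \<in> FKG G K"
proof (rule FKG_if_finite_image[OF assms(1-3)])
  interpret group G by fact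
  interpret K: subgroup K G by fact
  have B: "B \<subseteq> carrier G" using assms(3) by (simp add: PKG_simps)
  have "(\<lambda>b. K #>\<^bsub>G\<^esub> b) ` B \<subseteq> cosets_within G K B"
    using PKG_coset_subset_iff[OF assms(1-3)] B by (auto simp: cosets_within_def RCOSETS_def)
  then show "finite ((\<lambda>b. K #>\<^bsub>G\<^esub> b) ` B)" using assms(4) finite_subset by blast
  show "g \<in> K #>\<^bsub>G\<^esub> h" if "g \<in> B" "h \<in> B" "K #>\<^bsub>G\<^esub> g = K #>\<^bsub>G\<^esub> h" for g h
    using that rcos_self[of g K] B assms(2) by blast
qed

context
  fixes G :: "('g, 'r) monoid_scheme" and K A
  assumes G: "group G" and K: "subgroup K G" and A: "A \<in> carrier (PKG G K)"
begin

interpretation group G by (rule G)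
interpretation K: subgroup K G by (rule K)

private abbreviation (input) "S \<equiv> almost_equality_class G K A"

lemma class_sub: "B \<in> S \<Longrightarrow> B \<in> carrier (PKG G K)" "B \<in> S \<Longrightarrow> B \<subseteq> carrier G"
  by (auto simp: almost_equality_class_def PKG_simps)

lemma class_FKG: "B \<in> S \<Longrightarrow> sym_diff A B \<in> FKG G K"
  by (simp add: almost_equality_class_def)

lemma class_nonempty: "A \<in> S"
  using A FKG_empty by (simp add: almost_equality_class_def)

lemma class_sym_diff:
  assumes "B \<in> S" "C \<in> S"
  shows "sym_diff B C \<in> FKG G K"
proof -
  have "sym_diff (sym_diff A B) (sym_diff A C) \<in> FKG G K"
    using assms by - (rule FKG_sym_diff[OF G K], auto simp: almost_equality_class_def)
  also have "sym_diff (sym_diff A B) (sym_diff A C) = sym_diff B C" by blast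
  finally show ?thesis .
qed

text \<open>Where \<open>x\<close>, \<open>y\<close> and \<open>z\<close> all agree with \<open>A\<close>, so does their majority.\<close>

lemma class_majority:
  assumes "x \<in> S" "y \<in> S" "z \<in> S"
  shows "set_majority x y z \<in> S"
proof -
  note iff = PKG_mem_iff[OF G K class_sub(1)[OF assms(1)]] PKG_mem_iff[OF G K class_sub(1)[OF assms(2)]]
    PKG_mem_iff[OF G K class_sub(1)[OF assms(3)]]
  have P: "set_majority x y z \<in> carrier (PKG G K)"
  proof (rule PKG_I[OF G K])
    show "set_majority x y z \<subseteq> carrier G"
      using class_sub(2)[OF assms(1)] class_sub(2)[OF assms(2)] unfolding set_majority_def by blast
  qed (simp add: set_majority_def iff)
  have "sym_diff A x \<union> sym_diff A y \<union> sym_diff A z \<in> FKG G K"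
    using assms by (simp only: FKG_Un class_FKG)
  moreover have "sym_diff A (set_majority x y z) \<subseteq> sym_diff A x \<union> sym_diff A y \<union> sym_diff A z"
    unfolding set_majority_def by blast
  ultimately have "sym_diff A (set_majority x y z) \<in> FKG G K"
    using FKG_mono[OF G K _ _ PKG_sym_diff[OF G K A P]] by blast
  then show ?thesis using P by (simp add: almost_equality_class_def)
qed

text \<open>Intervals are finite: a point between \<open>x\<close> and \<open>y\<close> is free only on the finitely many cosets on
  which \<open>x\<close> and \<open>y\<close> disagree.\<close>

lemma class_discrete: "discrete_median_algebra S set_majority"
proof -
  interpret median_algebra S set_majority
    using class_nonempty class_majority by (intro median_algebra_of_sets) auto
  show ?thesis
  proof unfold_locales
    fix x y assume xy: "x \<in> S" "y \<in> S"
    obtain F where F: "finite F" "F \<subseteq> carrier G" "sym_diff x y = K <#>\<^bsub>G\<^esub> F"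
      using class_sym_diff[OF xy] by (auto simp: FKG_def)
    have "inj_on (\<lambda>B. B \<inter> F) (median_interval S set_majority x y)"
    proof (rule inj_onI)
      fix B C assume B: "B \<in> median_interval S set_majority x y"
        and C: "C \<in> median_interval S set_majority x y" and eq: "B \<inter> F = C \<inter> F"
      have BC: "B \<in> S" "C \<in> S" using B C by (auto simp: median_interval_def)
      note iff = PKG_mem_iff[OF G K class_sub(1)[OF BC(1)]] PKG_mem_iff[OF G K class_sub(1)[OF BC(2)]]
      have "b \<in> B \<longleftrightarrow> b \<in> C" for b
      proof (cases "b \<in> sym_diff x y")
        case True
        then obtain k f where kf: "k \<in> K" "f \<in> F" "b = k \<otimes>\<^bsub>G\<^esub> f"
          unfolding F(3) set_mult_def by blast
        then show ?thesis using iff[OF kf(1)] F(2) eq by blast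
      next
        case False
        then show ?thesis using B C unfolding median_interval_of_sets by blast
      qed
      then show "B = C" by blast
    qed
    moreover have "finite ((\<lambda>B. B \<inter> F) ` median_interval S set_majority x y)"
      using F(1) by - (rule finite_subset[of _ "Pow F"], auto)
    ultimately have "finite (median_interval S set_majority x y)" by (rule finite_imageD[rotated])
    then show "finite (separating_half_spaces S set_majority x y)"
      using finite_interval_imp_finite_separating xy by blast
  qed
qed

text \<open>Each coset \<open>c\<close> contained in \<open>x\<close> but not in \<open>y\<close> gives the half space of all sets containing \<open>c\<close>,
  which separates \<open>x\<close> from \<open>y\<close>. Different cosets \<open>c\<close> and \<open>d\<close> give different half spaces because \<open>x\<close>
  with \<open>c\<close> removed stays in the class and still contains \<open>d\<close>.\<close>

lemma cosets_between_le_median_dist: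
  assumes "x \<in> S" "y \<in> S"
  shows "finite (cosets_within G K x - cosets_within G K y)"
    "card (cosets_within G K x - cosets_within G K y) \<le> median_dist S set_majority x y"
proof -
  let ?D = "cosets_within G K x - cosets_within G K y"
  let ?H = "\<lambda>c. {B \<in> S. c \<subseteq> B}"
  have H: "?H (K #>\<^bsub>G\<^esub> a) = {B \<in> S. a \<in> B}" if "a \<in> carrier G" for a
    using PKG_coset_subset_iff[OF G K class_sub(1) that] by blast
  have fin: "finite (separating_half_spaces S set_majority x y)"
    using discrete_median_algebra.discrete[OF class_discrete] assms by blast
  have img: "?H ` ?D \<subseteq> separating_half_spaces S set_majority x y"
  proof
    fix U assume "U \<in> ?H ` ?D"
    then obtain a where a: "a \<in> carrier G" "K #>\<^bsub>G\<^esub> a \<in> ?D" "U = ?H (K #>\<^bsub>G\<^esub> a)"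
      by (auto simp: cosets_within_def RCOSETS_def)
    have "half_space S set_majority U"
      unfolding a(3) H[OF a(1)] by (rule half_space_of_point)
    moreover have "x \<in> U" "y \<notin> U" using a assms by (auto simp: cosets_within_def)
    ultimately show "U \<in> separating_half_spaces S set_majority x y"
      by (simp add: separating_half_spaces_def)
  qed
  have inj: "inj_on ?H ?D"
  proof (rule inj_onI, rule ccontr)
    fix c d assume c: "c \<in> ?D" and d: "d \<in> ?D" and eq: "?H c = ?H d" and ne: "c \<noteq> d"
    obtain a where a: "a \<in> carrier G" "c = K #>\<^bsub>G\<^esub> a" using c by (auto simp: cosets_within_def RCOSETS_def)
    have cd: "c \<in> rcosets\<^bsub>G\<^esub> K" "d \<in> rcosets\<^bsub>G\<^esub> K" "c \<subseteq> x" "d \<subseteq> x" using c d by (auto simp: cosets_within_def)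
    have disj: "c \<inter> d = {}"
      using rcos_disjoint[OF K] cd ne by (auto simp: pairwise_def disjnt_def)
    have cF: "c \<in> FKG G K"
      using a by (auto simp: FKG_def r_coset_def set_mult_def intro!: exI[of _ "{a}"])
    then have cP: "c \<in> carrier (PKG G K)" using FKG_closed[OF G K] by (auto simp: PKG_simps)
    have "sym_diff x c \<in> S"
    proof -
      have "sym_diff (sym_diff A x) c \<in> FKG G K"
        using assms cF by - (rule FKG_sym_diff[OF G K], auto simp: almost_equality_class_def)
      also have "sym_diff (sym_diff A x) c = sym_diff A (sym_diff x c)" by blast
      finally show ?thesis
        using PKG_sym_diff[OF G K class_sub(1)[OF assms(1)] cP] by (simp add: almost_equality_class_def)
    qed
    moreover have "d \<subseteq> sym_diff x c" using disj cd by blast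
    ultimately have "sym_diff x c \<in> ?H d" by simp
    then have "sym_diff x c \<in> ?H c" by (simp only: eq)
    then have "c \<subseteq> sym_diff x c" by simp
    moreover have "a \<in> c" using a rcos_self[OF _ K] by blast
    ultimately show False using cd by blast
  qed
  show "finite ?D" using inj_on_finite[OF inj img fin] .
  show "card ?D \<le> median_dist S set_majority x y"
    unfolding median_dist_def using card_inj_on_le[OF inj img fin] .
qed

lemma cosets_within_translate:
  assumes "B \<subseteq> carrier G" "g \<in> carrier G"
  shows "cosets_within G K (B #>\<^bsub>G\<^esub> g) = (\<lambda>c. c #>\<^bsub>G\<^esub> g) ` cosets_within G K B"
proof -
  have mono: "C #>\<^bsub>G\<^esub> h \<subseteq> D #>\<^bsub>G\<^esub> h" if "C \<subseteq> D" for C D h using that by (auto simp: r_coset_def)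
  have sub: "c \<subseteq> carrier G" if "c \<in> rcosets\<^bsub>G\<^esub> K" for c
    using that rcosets_subset_PowG[OF K] by blast
  have clos: "c #>\<^bsub>G\<^esub> h \<in> rcosets\<^bsub>G\<^esub> K" if "c \<in> rcosets\<^bsub>G\<^esub> K" "h \<in> carrier G" for c h
    using that by (auto simp: RCOSETS_def coset_mult_assoc[OF K.subset])
  show ?thesis
  proof (intro equalityI subsetI)
    fix c assume "c \<in> cosets_within G K (B #>\<^bsub>G\<^esub> g)"
    then have c: "c \<in> rcosets\<^bsub>G\<^esub> K" "c \<subseteq> B #>\<^bsub>G\<^esub> g" by (auto simp: cosets_within_def)
    have "c #>\<^bsub>G\<^esub> inv\<^bsub>G\<^esub> g \<subseteq> (B #>\<^bsub>G\<^esub> g) #>\<^bsub>G\<^esub> inv\<^bsub>G\<^esub> g" by (rule mono[OF c(2)])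
    also have "\<dots> = B" using assms by (simp add: coset_mult_assoc)
    finally have "c #>\<^bsub>G\<^esub> inv\<^bsub>G\<^esub> g \<in> cosets_within G K B"
      using clos[OF c(1)] assms by (simp add: cosets_within_def)
    moreover have "c = (c #>\<^bsub>G\<^esub> inv\<^bsub>G\<^esub> g) #>\<^bsub>G\<^esub> g"
      using sub[OF c(1)] assms by (simp add: coset_mult_assoc)
    ultimately show "c \<in> (\<lambda>c. c #>\<^bsub>G\<^esub> g) ` cosets_within G K B" by blast
  qed (use mono clos assms in \<open>auto simp: cosets_within_def\<close>)
qed

lemma class_translate:
  assumes inv: "\<And>g. g \<in> carrier G \<Longrightarrow> sym_diff A (A #>\<^bsub>G\<^esub> g) \<in> FKG G K"
    and B: "B \<in> S" and g: "g \<in> carrier G"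
  shows "B #>\<^bsub>G\<^esub> g \<in> S"
proof -
  have AG: "A \<subseteq> carrier G" using A by (simp add: PKG_simps)
  have "sym_diff (A #>\<^bsub>G\<^esub> g) (B #>\<^bsub>G\<^esub> g) \<in> FKG G K"
    using FKG_r_coset[OF G K _ g, of "sym_diff A B"] r_coset_sym_diff[OF G AG class_sub(2)[OF B] g] B
    by (simp add: almost_equality_class_def)
  then have "sym_diff (sym_diff A (A #>\<^bsub>G\<^esub> g)) (sym_diff (A #>\<^bsub>G\<^esub> g) (B #>\<^bsub>G\<^esub> g)) \<in> FKG G K"
    by (rule FKG_sym_diff[OF G K inv[OF g]])
  also have "sym_diff (sym_diff A (A #>\<^bsub>G\<^esub> g)) (sym_diff (A #>\<^bsub>G\<^esub> g) (B #>\<^bsub>G\<^esub> g))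
      = sym_diff A (B #>\<^bsub>G\<^esub> g)" by blast
  finally show ?thesis
    using class_sub[OF B] setmult_rcos_assoc[OF K.subset class_sub(2)[OF B] g]
      r_coset_subset_G[OF class_sub(2)[OF B] g]
    by (simp add: almost_equality_class_def PKG_simps)
qed

lemma r_coset_set_majority:
  assumes "x \<subseteq> carrier G" "y \<subseteq> carrier G" "z \<subseteq> carrier G" "g \<in> carrier G"
  shows "set_majority x y z #>\<^bsub>G\<^esub> g = set_majority (x #>\<^bsub>G\<^esub> g) (y #>\<^bsub>G\<^esub> g) (z #>\<^bsub>G\<^esub> g)"
proof -
  have e: "C #>\<^bsub>G\<^esub> g = (\<lambda>a. a \<otimes>\<^bsub>G\<^esub> g) ` C" for C by (auto simp: r_coset_def)
  have "inj_on (\<lambda>a. a \<otimes>\<^bsub>G\<^esub> g) (carrier G)" using assms(4) by (simp add: inj_on_def)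
  note int = inj_on_image_Int[OF this]
  show ?thesis
    unfolding e set_majority_def image_Un
    using int[OF assms(1,2)] int[OF assms(2,3)] int[OF assms(1,3)] by simp
qed

text \<open>A bounded orbit of a point \<open>x\<close> bounds the number of cosets by which \<open>x\<close> differs from its
  translates, since this number is at most the sum of the two distances. The transitive action on
  the cosets then forces \<open>x\<close> or its complement to be \<open>K\<close>-finite, and hence the same for \<open>A\<close>, which
  differs from \<open>x\<close> by a \<open>K\<close>-finite set.\<close>

lemma class_action_non_elliptic:
  assumes inv: "\<And>g. g \<in> carrier G \<Longrightarrow> sym_diff A (A #>\<^bsub>G\<^esub> g) \<in> FKG G K"
    and notF: "A \<notin> FKG G K" "carrier G - A \<notin> FKG G K"
  defines "\<phi> \<equiv> \<lambda>g. \<lambda>B\<in>S. B #>\<^bsub>G\<^esub> inv\<^bsub>G\<^esub> g"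
  shows "median_action G S set_majority \<phi>" "\<not> elliptic_action G S set_majority \<phi>"
proof -
  interpret discrete_median_algebra S set_majority by (rule class_discrete)
  interpret act: group_action G S \<phi>
    unfolding \<phi>_def using class_sub class_translate[OF inv] by (intro right_translation_action[OF G]) auto
  show "median_action G S set_majority \<phi>"
  proof unfold_locales
    fix g x y z assume "g \<in> carrier G" "x \<in> S" "y \<in> S" "z \<in> S"
    then show "\<phi> g (set_majority x y z) = set_majority (\<phi> g x) (\<phi> g y) (\<phi> g z)"
      using r_coset_set_majority class_sub(2) class_majority by (simp add: \<phi>_def)
  qed
  show "\<not> elliptic_action G S set_majority \<phi>"
  proof
    assume "elliptic_action G S set_majority \<phi>"
    then obtain x n where x: "x \<in> S" and
      n: "\<And>y z. y \<in> orbit G \<phi> x \<Longrightarrow> z \<in> orbit G \<phi> x \<Longrightarrow> median_dist S set_majority y z \<le> n"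
      unfolding elliptic_action_def by blast
    let ?C = "cosets_within G K"
    let ?\<psi> = "\<lambda>g. \<lambda>c\<in>rcosets\<^bsub>G\<^esub> K. c #>\<^bsub>G\<^esub> inv\<^bsub>G\<^esub> g"
    interpret cosets: transitive_action G "rcosets\<^bsub>G\<^esub> K" ?\<psi> by (rule coset_action_transitive[OF G K])
    have Csub: "?C x \<subseteq> rcosets\<^bsub>G\<^esub> K" by (auto simp: cosets_within_def)
    have "finite (?C x) \<or> finite (rcosets\<^bsub>G\<^esub> K - ?C x)"
    proof (rule cosets.bounded_commensuration[OF Csub])
      fix g assume g: "g \<in> carrier G"
      have y: "\<phi> g x \<in> orbit G \<phi> x" "\<phi> g x \<in> S" and x': "x \<in> orbit G \<phi> x"
        using g x act.orbit_refl act.element_image by (auto simp: orbit_def)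
      have "?\<psi> g ` ?C x = (\<lambda>c. c #>\<^bsub>G\<^esub> inv\<^bsub>G\<^esub> g) ` ?C x" using Csub by (intro image_cong) auto
      also have "\<dots> = ?C (\<phi> g x)"
        using cosets_within_translate[OF class_sub(2)[OF x] inv_closed[OF g]] x by (simp add: \<phi>_def)
      finally have im: "?\<psi> g ` ?C x = ?C (\<phi> g x)" .
      note le = cosets_between_le_median_dist[OF x y(2)] cosets_between_le_median_dist[OF y(2) x]
      have "card (sym_diff (?C (\<phi> g x)) (?C x)) \<le>
          median_dist S set_majority (\<phi> g x) x + median_dist S set_majority x (\<phi> g x)"
        by (rule order_trans[OF card_Un_le add_mono[OF le(4) le(2)]])
      also have "\<dots> \<le> n + n" using n x' y(1) by (intro add_mono) auto
      finally show "finite (sym_diff (?\<psi> g ` ?C x) (?C x)) \<and> card (sym_diff (?\<psi> g ` ?C x) (?C x)) \<le> n + n"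
        unfolding im using le by blast
    qed
    moreover have "x \<notin> FKG G K"
    proof
      assume "x \<in> FKG G K"
      then have "sym_diff x (sym_diff A x) \<in> FKG G K"
        using x by - (rule FKG_sym_diff[OF G K], auto simp: almost_equality_class_def)
      also have "sym_diff x (sym_diff A x) = A" by blast
      finally show False using notF by simp
    qed
    moreover have "carrier G - x \<notin> FKG G K"
    proof
      assume "carrier G - x \<in> FKG G K"
      then have "sym_diff (carrier G - x) (sym_diff A x) \<in> FKG G K"
        using x by - (rule FKG_sym_diff[OF G K], auto simp: almost_equality_class_def)
      also have "sym_diff (carrier G - x) (sym_diff A x) = carrier G - A"
        using A class_sub(2)[OF x] by (auto simp: PKG_simps)
      finally show False using notF by simp
    qed
    moreover have "carrier G - x \<in> carrier (PKG G K)"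
      using PKG_sym_diff[OF G K PKG_carrier[OF G K] class_sub(1)[OF x]] class_sub(2)[OF x]
      by (metis Diff_eq_empty_iff Un_empty_right)
    moreover have "cosets_within G K (carrier G - x) \<subseteq> rcosets\<^bsub>G\<^esub> K - ?C x"
    proof
      fix c assume c: "c \<in> cosets_within G K (carrier G - x)"
      then obtain a where "a \<in> carrier G" "c = K #>\<^bsub>G\<^esub> a" by (auto simp: cosets_within_def RCOSETS_def)
      then have "a \<in> c" using rcos_self[OF _ K] by blast
      then show "c \<in> rcosets\<^bsub>G\<^esub> K - ?C x" using c by (auto simp: cosets_within_def)
    qed
    ultimately show False
      using FKG_if_finite_cosets_within[OF G K] class_sub(1)[OF x] finite_subset by blast
  qed
qed

end

section \<open>Half spaces of a median action\<close>

context median_action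
begin

interpretation group G using group_hom group_hom.axioms(1) by blast

lemma image_mult:
  assumes "g \<in> carrier G" "h \<in> carrier G" "H \<subseteq> M"
  shows "\<phi> g ` \<phi> h ` H = \<phi> (g \<otimes> h) ` H"
  using assms by (auto simp: image_image composition_rule subset_iff intro!: image_cong)

lemma image_one: "H \<subseteq> M \<Longrightarrow> \<phi> \<one> ` H = H"
  by (auto simp: id_eq_one[symmetric] subset_iff image_iff)

lemma image_subset: "g \<in> carrier G \<Longrightarrow> H \<subseteq> M \<Longrightarrow> \<phi> g ` H \<subseteq> M"
  using surj_prop by blast

lemma image_inv:
  assumes "g \<in> carrier G" "H \<subseteq> M"
  shows "\<phi> g ` \<phi> (inv g) ` H = H" "\<phi> (inv g) ` \<phi> g ` H = H"
  using assms by (simp_all add: image_mult image_one)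

lemma mem_image_iff:
  assumes "g \<in> carrier G" "H \<subseteq> M" "y \<in> M"
  shows "y \<in> \<phi> g ` H \<longleftrightarrow> \<phi> (inv g) y \<in> H"
proof
  assume "y \<in> \<phi> g ` H"
  then have "\<phi> (inv g) y \<in> \<phi> (inv g) ` \<phi> g ` H" by blast
  then show "\<phi> (inv g) y \<in> H" using image_inv(2)[OF assms(1,2)] by simp
next
  assume "\<phi> (inv g) y \<in> H"
  then have "\<phi> g (\<phi> (inv g) y) \<in> \<phi> g ` H" by blast
  moreover have "\<phi> g (\<phi> (inv g) y) = y"
    using assms orbit_sym_aux[of "inv g" y] by simp
  ultimately show "y \<in> \<phi> g ` H" by simp
qed

lemma convex_image:
  assumes g: "g \<in> carrier G" and C: "median_convex M m C"
  shows "median_convex M m (\<phi> g ` C)"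
proof -
  have CM: "C \<subseteq> M" using C by (simp add: median_convex_def)
  have "z \<in> \<phi> g ` C" if xy: "x \<in> C" "y \<in> C" and z: "z \<in> median_interval M m (\<phi> g x) (\<phi> g y)" for x y z
  proof -
    obtain w where w: "w \<in> M" "z = \<phi> g w"
      using z surj_prop[OF g] by (auto simp: median_interval_def)
    have xyM: "x \<in> M" "y \<in> M" using xy CM by blast+
    have "\<phi> g w = m (\<phi> g x) (\<phi> g y) (\<phi> g w)"
      using z unfolding w(2) median_interval_def by blast
    also have "\<dots> = \<phi> g (m x y w)" by (rule median_preserving[OF g xyM w(1), symmetric])
    finally have "w = m x y w" by (rule inj_onD[OF inj_prop[OF g] _ w(1) closed[OF xyM w(1)]])
    then have "w \<in> C" using C xy w unfolding median_convex_def median_interval_def by blast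
    then show ?thesis using w by blast
  qed
  then show ?thesis using image_subset[OF g CM] unfolding median_convex_def by blast
qed

lemma half_space_image:
  assumes g: "g \<in> carrier G" and H: "half_space M m H"
  shows "half_space M m (\<phi> g ` H)"
proof -
  have "H \<subseteq> M" using H by (simp add: half_space_def)
  then have "M - \<phi> g ` H = \<phi> g ` (M - H)"
    using inj_on_image_set_diff[OF inj_prop[OF g], of M H] surj_prop[OF g] by auto
  then show ?thesis
    using H convex_image[OF g] image_subset[OF g] unfolding half_space_def by auto
qed

lemma separating_translate:
  assumes "H \<in> separating_half_spaces M m y z" "g \<in> carrier G" "y \<in> M" "z \<in> M"
  shows "\<phi> g ` H \<in> separating_half_spaces M m (\<phi> g y) (\<phi> g z)"
proof -
  have H: "half_space M m H" "H \<subseteq> M" "y \<in> H" "z \<notin> H"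
    using assms(1) by (auto simp: separating_half_spaces_def half_space_def)
  have "\<phi> g z \<notin> \<phi> g ` H" using inj_on_image_mem_iff[OF inj_prop] assms H by blast
  then show ?thesis
    using half_space_image H assms by (auto simp: separating_half_spaces_def)
qed

abbreviation (input) "setwise_stabilizer H \<equiv> {g \<in> carrier G. \<phi> g ` H = H}"

lemma setwise_stabilizer_subgroup:
  assumes "H \<subseteq> M"
  shows "subgroup (setwise_stabilizer H) G"
proof (rule subgroupI)
  show "setwise_stabilizer H \<noteq> {}" using image_one[OF assms] one_closed by blast
  show "inv g \<in> setwise_stabilizer H" if "g \<in> setwise_stabilizer H" for g
    using that image_inv(2)[of g H] assms by auto
  show "g \<otimes> h \<in> setwise_stabilizer H" if "g \<in> setwise_stabilizer H" "h \<in> setwise_stabilizer H" for g h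
    using that image_mult[of g h H, symmetric] assms by simp
qed auto

text \<open>The set whose class modulo the \<open>K\<close>-finite sets, for \<open>K\<close> the stabilizer of \<open>H\<close>, is the candidate for
  a second end.\<close>

abbreviation (input) "hits x H \<equiv> {h \<in> carrier G. \<phi> h x \<in> H}"

lemma hits_PKG:
  assumes "H \<subseteq> M" "x \<in> M"
  shows "hits x H \<in> carrier (PKG G (setwise_stabilizer H))"
proof (rule PKG_I[OF is_group setwise_stabilizer_subgroup[OF assms(1)]])
  fix k h assume k: "k \<in> setwise_stabilizer H" and h: "h \<in> carrier G" "h \<in> hits x H"
  then have "\<phi> k (\<phi> h x) \<in> H" by blast
  then show "k \<otimes> h \<in> hits x H" using k h composition_rule[OF assms(2)] by auto
qed auto

text \<open>An element \<open>h\<close> belongs to the symmetric difference exactly if \<open>h\<^sup>-\<^sup>1 H\<close> separates \<open>x\<close> from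
  \<open>g\<^sup>-\<^sup>1 x\<close>. By discreteness there are finitely many such translates, and each of them determines
  \<open>h\<close> up to left multiplication by the stabilizer of \<open>H\<close>.\<close>

lemma hits_translate_FKG:
  assumes "discrete_median_algebra M m" "half_space M m H" "x \<in> M" "g \<in> carrier G"
  shows "sym_diff (hits x H) (hits x H #> g) \<in> FKG G (setwise_stabilizer H)"
    (is "?D \<in> FKG G ?K")
proof -
  interpret discrete_median_algebra M m by fact
  have HM: "H \<subseteq> M" using assms(2) by (simp add: half_space_def)
  have K: "subgroup ?K G" by (rule setwise_stabilizer_subgroup[OF HM])
  let ?y = "\<phi> (inv g) x"
  have y: "?y \<in> M" using assms element_image by blast
  have AP: "hits x H \<in> carrier (PKG G ?K)" by (rule hits_PKG[OF HM assms(3)])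
  have shift: "hits x H #> g = hits ?y H"
  proof (intro equalityI subsetI)
    fix h assume "h \<in> hits x H #> g"
    then obtain a where a: "a \<in> carrier G" "\<phi> a x \<in> H" "h = a \<otimes> g" by (auto simp: r_coset_def)
    have "\<phi> h ?y = \<phi> (h \<otimes> inv g) x" using composition_rule assms a by simp
    also have "h \<otimes> inv g = a" using a assms by (simp add: m_assoc)
    finally show "h \<in> hits ?y H" using a assms by simp
  next
    fix h assume h: "h \<in> hits ?y H"
    then have "h \<otimes> inv g \<in> hits x H" using composition_rule assms by simp
    moreover have "h = h \<otimes> inv g \<otimes> g" using h assms by (simp add: m_assoc)
    ultimately show "h \<in> hits x H #> g" unfolding r_coset_def by blast
  qed
  have DP: "?D \<in> carrier (PKG G ?K)"
    unfolding shift by (rule PKG_sym_diff[OF is_group K AP hits_PKG[OF HM y]])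
  show ?thesis
  proof (rule FKG_if_finite_image[OF is_group K DP, where f = "\<lambda>h. \<phi> (inv h) ` H"])
    have "(\<lambda>h. \<phi> (inv h) ` H) ` ?D \<subseteq>
        separating_half_spaces M m x ?y \<union> separating_half_spaces M m ?y x"
    proof (intro image_subsetI)
      fix h assume h: "h \<in> ?D"
      then have hG: "h \<in> carrier G" unfolding shift by blast
      have iff: "z \<in> \<phi> (inv h) ` H \<longleftrightarrow> \<phi> h z \<in> H" if "z \<in> M" for z
        using mem_image_iff[OF inv_closed[OF hG] HM that] hG by simp
      have "(\<phi> h x \<in> H) \<noteq> (\<phi> h ?y \<in> H)" using h hG unfolding shift by blast
      then have "(x \<in> \<phi> (inv h) ` H) \<noteq> (?y \<in> \<phi> (inv h) ` H)"
        unfolding iff[OF y] iff[OF assms(3)] .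
      then show "\<phi> (inv h) ` H \<in> separating_half_spaces M m x ?y \<union> separating_half_spaces M m ?y x"
        using half_space_image[OF inv_closed[OF hG] assms(2)] unfolding separating_half_spaces_def by blast
    qed
    then show "finite ((\<lambda>h. \<phi> (inv h) ` H) ` ?D)"
      by (rule finite_subset) (simp add: discrete y assms(3))
    fix a b assume ab: "a \<in> ?D" "b \<in> ?D" and eq: "\<phi> (inv a) ` H = \<phi> (inv b) ` H"
    then have c: "a \<in> carrier G" "b \<in> carrier G" unfolding shift by auto
    have "\<phi> (a \<otimes> inv b) ` H = \<phi> a ` \<phi> (inv b) ` H" using c HM by (simp add: image_mult)
    also have "\<dots> = H" unfolding eq[symmetric] using c HM by (simp add: image_inv)
    finally have "a \<otimes> inv b \<in> ?K" using c by simp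
    moreover have "a = a \<otimes> inv b \<otimes> b" using c by (simp add: m_assoc)
    ultimately show "a \<in> ?K #> b" unfolding r_coset_def by blast
  qed
qed

abbreviation (input) "separating_translates H x y \<equiv>
  {\<phi> h ` H |h. h \<in> carrier G \<and> x \<in> \<phi> h ` H \<and> y \<notin> \<phi> h ` H}"

text \<open>If the stabilizer \<open>K\<close> has at most one end, then \<open>hits x H\<close> or its complement has the form \<open>K F\<close>
  with \<open>F\<close> finite. In the first case \<open>x \<in> h H\<close> means \<open>h\<^sup>-\<^sup>1 \<in> K F\<close>, so that \<open>h H = f\<^sup>-\<^sup>1 H\<close> for some \<open>f\<close> in
  \<open>F\<close>. In the second case \<open>g x \<notin> h H\<close> means \<open>h\<^sup>-\<^sup>1 g \<in> K F\<close>, so that \<open>h H = g f\<^sup>-\<^sup>1 H\<close>. Either way there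
  are at most as many translates as elements of \<open>F\<close>, whatever \<open>g\<close> is.\<close>

lemma one_end_bounds_separating_translates:
  assumes "discrete_median_algebra M m" "half_space M m H" "x \<in> M"
    and one_end: "\<not> ends G (setwise_stabilizer H) > 1"
  shows "\<exists>n. \<forall>g\<in>carrier G. finite (separating_translates H x (\<phi> g x)) \<and>
    card (separating_translates H x (\<phi> g x)) \<le> n"
proof -
  have HM: "H \<subseteq> M" using assms(2) by (simp add: half_space_def)
  let ?K = "setwise_stabilizer H" and ?A = "hits x H"
  have K: "subgroup ?K G" by (rule setwise_stabilizer_subgroup[OF HM])
  have "?A \<in> FKG G ?K \<or> carrier G - ?A \<in> FKG G ?K"
    using one_end ends_gt_1_iff[OF is_group K] hits_PKG[OF HM assms(3)] hits_translate_FKG[OF assms(1-3)]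
    by blast
  then obtain F where F: "finite F" "F \<subseteq> carrier G" "?A = ?K <#> F \<or> carrier G - ?A = ?K <#> F"
    by (auto simp: FKG_def)
  have mv: "\<phi> (inv (k \<otimes> f)) ` H = \<phi> (inv f) ` H" if "k \<in> ?K" "f \<in> carrier G" for k f
  proof -
    have "inv k \<in> ?K" using that subgroup.m_inv_closed[OF K] by blast
    then show ?thesis using that image_mult[of "inv f" "inv k" H] HM by (simp add: inv_mult_group)
  qed
  have "finite (separating_translates H x (\<phi> g x)) \<and> card (separating_translates H x (\<phi> g x)) \<le> card F"
    if g: "g \<in> carrier G" for g
  proof -
    obtain t where t: "separating_translates H x (\<phi> g x) \<subseteq> t ` F"
    proof (cases "?A = ?K <#> F")
      case True
      have "separating_translates H x (\<phi> g x) \<subseteq> (\<lambda>f. \<phi> (inv f) ` H) ` F"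
      proof
        fix U assume "U \<in> separating_translates H x (\<phi> g x)"
        then obtain h where h: "h \<in> carrier G" "U = \<phi> h ` H" "x \<in> \<phi> h ` H" by blast
        then have "inv h \<in> ?A" using mem_image_iff[OF h(1) HM assms(3)] by simp
        then obtain k f where kf: "k \<in> ?K" "f \<in> F" "inv h = k \<otimes> f" unfolding True set_mult_def by blast
        then have "U = \<phi> (inv f) ` H" using mv[OF kf(1), of f] F h by (auto simp flip: kf(3))
        then show "U \<in> (\<lambda>f. \<phi> (inv f) ` H) ` F" using kf by blast
      qed
      then show ?thesis using that by blast
    next
      case False
      then have cA: "carrier G - ?A = ?K <#> F" using F by blast
      have "separating_translates H x (\<phi> g x) \<subseteq> (\<lambda>f. \<phi> g ` \<phi> (inv f) ` H) ` F"
      proof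
        fix U assume "U \<in> separating_translates H x (\<phi> g x)"
        then obtain h where h: "h \<in> carrier G" "U = \<phi> h ` H" "\<phi> g x \<notin> \<phi> h ` H" by blast
        then have "\<phi> (inv h) (\<phi> g x) \<notin> H"
          using mem_image_iff[OF h(1) HM] element_image[OF g assms(3)] by blast
        then have "inv h \<otimes> g \<in> carrier G - ?A" using composition_rule[OF assms(3)] g h by simp
        then obtain k f where kf: "k \<in> ?K" "f \<in> F" "inv h \<otimes> g = k \<otimes> f"
          unfolding cA set_mult_def by blast
        have "\<phi> (inv (inv h \<otimes> g)) ` H = \<phi> (inv f) ` H"
          unfolding kf(3) using mv[OF kf(1)] kf(2) F by blast
        then have "\<phi> g ` \<phi> (inv f) ` H = \<phi> g ` \<phi> (inv g \<otimes> h) ` H" using g h by (simp add: inv_mult_group)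
        also have "\<dots> = U" using g h HM by (simp add: image_mult m_assoc[symmetric])
        finally show "U \<in> (\<lambda>f. \<phi> g ` \<phi> (inv f) ` H) ` F" using kf by blast
      qed
      then show ?thesis using that by blast
    qed
    show ?thesis
      using finite_subset[OF t] F(1) card_mono[OF _ t] card_image_le[OF F(1), of t] by fastforce
  qed
  then show ?thesis by blast
qed

text \<open>Write \<open>g\<close> as a word in the generators. Along the corresponding path in the orbit from \<open>x\<close> to \<open>g x\<close>,
  some step crosses the wall of \<open>H\<close>, and every step is a translate of one from \<open>x\<close> to \<open>s x\<close>, up to
  direction.\<close>

lemma separating_translate_of_generator_wall:
  assumes g: "g \<in> generate G T" and T: "T \<subseteq> carrier G" and x: "x \<in> M"
    and H: "half_space M m H" "(x \<in> H) \<noteq> (\<phi> g x \<in> H)"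
  shows "\<exists>h\<in>carrier G. \<exists>s\<in>T. \<exists>U \<in> separating_half_spaces M m x (\<phi> s x) \<union>
    separating_half_spaces M m (\<phi> s x) x. H = \<phi> h ` U"
  using g H
proof (induction arbitrary: H rule: generate.induct)
  case one
  then show ?case using id_eq_one x by (metis restrict_apply')
next
  case (incl s)
  then have "H = \<phi> \<one> ` H" using image_one by (auto simp: half_space_def)
  then show ?case using incl one_closed by (auto simp: separating_half_spaces_def)
next
  case (inv s)
  have s: "s \<in> carrier G" and HM: "H \<subseteq> M" using inv T by (auto simp: half_space_def)
  have "\<phi> s x \<in> \<phi> s ` H \<longleftrightarrow> x \<in> H" using inj_on_image_mem_iff[OF inj_prop[OF s] x HM] .
  moreover have "x \<in> \<phi> s ` H \<longleftrightarrow> \<phi> (inv s) x \<in> H" by (rule mem_image_iff[OF s HM x])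
  ultimately have "\<phi> s ` H \<in> separating_half_spaces M m x (\<phi> s x) \<union> separating_half_spaces M m (\<phi> s x) x"
    using half_space_image[OF s] inv by (auto simp: separating_half_spaces_def)
  moreover have "H = \<phi> (inv s) ` \<phi> s ` H" using image_inv s HM by simp
  ultimately show ?case using inv(1) s inv_closed by blast
next
  case (eng g1 g2)
  have g: "g1 \<in> carrier G" "g2 \<in> carrier G" using eng.hyps generate_in_carrier[OF T] by auto
  have HM: "H \<subseteq> M" using eng.prems by (simp add: half_space_def)
  show ?case
  proof (cases "(x \<in> H) = (\<phi> g1 x \<in> H)")
    case False
    then show ?thesis using eng.IH(1) eng.prems by blast
  next
    case True
    let ?H = "\<phi> (inv g1) ` H"
    have iff: "y \<in> ?H \<longleftrightarrow> \<phi> g1 y \<in> H" if "y \<in> M" for y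
      using mem_image_iff[of "inv g1" H y] g HM that by simp
    have "(x \<in> ?H) \<noteq> (\<phi> g2 x \<in> ?H)"
      using True eng.prems(2) iff[OF x] iff[OF element_image[OF g(2) x refl]] composition_rule[OF x g] by simp
    then obtain h s U where hsU: "h \<in> carrier G" "s \<in> T" "?H = \<phi> h ` U"
      "U \<in> separating_half_spaces M m x (\<phi> s x) \<union> separating_half_spaces M m (\<phi> s x) x"
      using eng.IH(2)[of ?H] half_space_image g eng.prems by blast
    have "U \<subseteq> M" using hsU(4) by (auto simp: separating_half_spaces_def half_space_def)
    then have "H = \<phi> (g1 \<otimes> h) ` U"
      using image_inv(1)[OF g(1) HM] hsU g by (simp add: image_mult)
    then show ?thesis using hsU g m_closed by blast
  qed
qed

text \<open>Up to translation, only the finitely many half spaces that separate \<open>x\<close> from its images under the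
  generators ever separate two points of the orbit, and each of them contributes boundedly many
  translates to every distance.\<close>

lemma elliptic_if_one_end:
  assumes "discrete_median_algebra M m" and fg: "finitely_generated_group G"
    and one_end: "\<And>K. subgroup K G \<Longrightarrow> \<not> ends G K > 1"
  shows "elliptic_action G M m \<phi>"
proof -
  interpret discrete_median_algebra M m by fact
  obtain T where T: "finite T" "T \<subseteq> carrier G" "generate G T = carrier G"
    using fg by (auto simp: finitely_generated_group_def)
  obtain x where x: "x \<in> M" using nonempty by blast
  define W where "W = (\<Union>s\<in>T. separating_half_spaces M m x (\<phi> s x) \<union> separating_half_spaces M m (\<phi> s x) x)"
  have finW: "finite W" unfolding W_def using T x element_image by (auto intro!: discrete)
  have Whs: "half_space M m H" if "H \<in> W" for H
    using that by (auto simp: W_def separating_half_spaces_def)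
  have "\<forall>H\<in>W. \<exists>n. \<forall>g\<in>carrier G. finite (separating_translates H x (\<phi> g x)) \<and>
      card (separating_translates H x (\<phi> g x)) \<le> n"
  proof
    fix H assume "H \<in> W"
    then have hs: "half_space M m H" by (rule Whs)
    then have "H \<subseteq> M" by (simp add: half_space_def)
    then show "\<exists>n. \<forall>g\<in>carrier G. finite (separating_translates H x (\<phi> g x)) \<and>
        card (separating_translates H x (\<phi> g x)) \<le> n"
      by (intro one_end_bounds_separating_translates[OF assms(1) hs x] one_end setwise_stabilizer_subgroup)
  qed
  from bchoice[OF this] obtain n where "\<forall>H\<in>W. \<forall>g\<in>carrier G.
      finite (separating_translates H x (\<phi> g x)) \<and> card (separating_translates H x (\<phi> g x)) \<le> n H"
    by (elim exE)
  note n = this[rule_format]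
  have bound: "median_dist M m x (\<phi> g x) \<le> sum n W" if g: "g \<in> carrier G" for g
  proof -
    have "separating_half_spaces M m x (\<phi> g x) \<subseteq> (\<Union>H\<in>W. separating_translates H x (\<phi> g x))"
    proof
      fix V assume V: "V \<in> separating_half_spaces M m x (\<phi> g x)"
      then have "half_space M m V" "x \<in> V" "\<phi> g x \<notin> V" by (auto simp: separating_half_spaces_def)
      moreover have "g \<in> generate G T" using T g by simp
      ultimately obtain h U where "h \<in> carrier G" "U \<in> W" "V = \<phi> h ` U"
        using separating_translate_of_generator_wall[OF _ T(2) x] unfolding W_def by blast
      then show "V \<in> (\<Union>H\<in>W. separating_translates H x (\<phi> g x))"
        using \<open>x \<in> V\<close> \<open>\<phi> g x \<notin> V\<close> by blast
    qed
    then have "median_dist M m x (\<phi> g x) \<le> card (\<Union>H\<in>W. separating_translates H x (\<phi> g x))"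
      unfolding median_dist_def using finW n[OF _ g] by (intro card_mono finite_UN_I) blast+
    also have "\<dots> \<le> (\<Sum>H\<in>W. card (separating_translates H x (\<phi> g x)))"
      by (rule card_UN_le[OF finW])
    also have "\<dots> \<le> sum n W" using n[OF _ g] by (intro sum_mono) blast
    finally show ?thesis .
  qed
  have "median_dist M m (\<phi> a x) (\<phi> b x) \<le> sum n W" if a: "a \<in> carrier G" and b: "b \<in> carrier G" for a b
  proof -
    have M: "\<phi> a x \<in> M" "\<phi> b x \<in> M" using a b x element_image by blast+
    have e: "\<phi> (inv a) (\<phi> a x) = x" "\<phi> (inv a) (\<phi> b x) = \<phi> (inv a \<otimes> b) x"
      using composition_rule[OF x] orbit_sym_aux[OF a x refl] a b by auto
    have "inj_on (\<lambda>H. \<phi> (inv a) ` H) (separating_half_spaces M m (\<phi> a x) (\<phi> b x))"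
      using image_inv(1)[OF a] by (intro inj_on_inverseI[where g = "\<lambda>H. \<phi> a ` H"])
        (auto simp: separating_half_spaces_def half_space_def)
    moreover have "(\<lambda>H. \<phi> (inv a) ` H) ` separating_half_spaces M m (\<phi> a x) (\<phi> b x)
        \<subseteq> separating_half_spaces M m x (\<phi> (inv a \<otimes> b) x)"
      using separating_translate[OF _ inv_closed[OF a] M] unfolding e by blast
    ultimately have "median_dist M m (\<phi> a x) (\<phi> b x) \<le> median_dist M m x (\<phi> (inv a \<otimes> b) x)"
      unfolding median_dist_def
      by (rule card_inj_on_le[OF _ _ discrete[OF x element_image[OF m_closed[OF inv_closed[OF a] b] x refl]]])
    also have "\<dots> \<le> sum n W" using bound a b by simp
    finally show ?thesis .
  qed
  then show ?thesis unfolding elliptic_action_def orbit_def using x by blast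
qed

end

section \<open>The equivalence\<close>

theorem ends_if_non_elliptic_action:
  assumes "finitely_generated_group G" "admits_non_elliptic_action TYPE('m) G"
  shows "\<exists>K. subgroup K G \<and> ends G K > 1"
  using median_action.elliptic_if_one_end[OF _ _ assms(1)] assms(2)
  unfolding admits_non_elliptic_action_def by blast

theorem non_elliptic_action_if_ends:
  fixes G :: "('g, 'r) monoid_scheme"
  assumes G: "group G" and K: "subgroup K G" and ends: "ends G K > 1"
  shows "admits_non_elliptic_action TYPE('g set) G"
proof -
  obtain A where A: "A \<in> carrier (PKG G K)" "A \<notin> FKG G K" "carrier G - A \<notin> FKG G K"
    "\<And>g. g \<in> carrier G \<Longrightarrow> sym_diff A (A #>\<^bsub>G\<^esub> g) \<in> FKG G K"
    using ends unfolding ends_gt_1_iff[OF G K] by blast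
  show ?thesis
    unfolding admits_non_elliptic_action_def
    using class_discrete[OF G K A(1)] class_action_non_elliptic[OF G K A(1,4,2,3)] by blast
qed

theorem theorem11p6:
  fixes G :: "('g, 'r) monoid_scheme"
  assumes "finitely_generated_group G"
  shows "((\<exists>K. subgroup K G \<and> ends G K > 1) \<longleftrightarrow> admits_non_elliptic_action TYPE('g set) G)
       \<and> (admits_non_elliptic_action TYPE('m) G \<longrightarrow> (\<exists>K. subgroup K G \<and> ends G K > 1))"
proof -
  have "group G" using assms by (simp add: finitely_generated_group_def)
  then show ?thesis
    by (intro conjI iffI impI)
      (blast intro: non_elliptic_action_if_ends, (rule ends_if_non_elliptic_action[OF assms], assumption)+)
qed

end
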